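(* Let $a=(a_i)_{i\in\mathbb Z}$ be any sequence of complex numbers and $\mu$ a Young diagram. For all $x=(x_1,x_2,\dots)$, $y=(y_1,y_2,\dots)$ with finitely many nonzero coordinates, $$s_{\mu;a}(x;y)=\sum_{\mathcal T}\prod_{k\ge1}f_{\mathcal T^{-1}(k);a}(x_k,y_k),$$ summed over all diagonal-strict tableaux $\mathcal T$ of shape $\mu$.
   Context: $\Lambda$ is the algebra of symmetric functions over $\mathbb C$ with complete homogeneous $h_k$, elementary $e_k$, power sums $\mathbf p_k$. For a sequence $a$ define $h_{k;a}=\sum_{i=1}^k(-1)^{k-i}e_{k-i}(a_1,\dots,a_{k-1})h_i$ ($k\ge1$), $h_{0;a}=1$, $h_{k;a}=0$ ($k<0$); $(\tau^ra)_i=a_{i+r}$; $s_{\mu;a}=\det[h_{\mu_i-i+j;\,\tau^{1-j}a}]_{i,j=1}^N$ for any $N\ge\ell(\mu)$. Each $f\in\Lambda$ is a function $f(x;y)$ via $\mathbf p_k\mapsto\sum_ix_i^k+(-1)^{k-1}\sum_jy_j^k$. Let $\mathbb Z'=\mathbb Z+\tfrac12$ and $a'_\varepsilon=a_{\varepsilon+1/2}$ for $\varepsilon\in\mathbb Z'$. The box $(i,j)$ (row $i$, column $j$) is the unit square $[i-1,i]\times[j-1,j]$ in coordinates where the first axis points down and the second to the right. For a skew hook $\nu$ (a connected skew diagram with no $2\times2$ block of boxes), an interior side is a unit segment shared by two boxes of $\nu$ (there are $|\nu|-1$ of them); write $s=(\varepsilon,\delta)$ for its midpoint; it is vertical if $\varepsilon\in\mathbb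 Z'$, $\delta\in\mathbb Z$ and horizontal if $\varepsilon\in\mathbb Z$, $\delta\in\mathbb Z'$; in both cases $\delta-\varepsilon\in\mathbb Z'$. Define $f_{\nu;a}(u,v)=(u+v)\prod_{\text{vertical }s=(\varepsilon,\delta)}(u-a'_{\delta-\varepsilon})\prod_{\text{horizontal }s=(\varepsilon,\delta)}(v+a'_{\delta-\varepsilon})$. For a skew diagram $\nu$ with no $2\times2$ block, $f_{\nu;a}$ is the product of the polynomials of its connected components (skew hooks), and $f_{\varnothing;a}=1$. A diagonal-strict tableau of shape $\mu$ is a map $\mathcal T$ from the boxes of $\mu$ to $\{1,2,\dots\}$ weakly increasing along each row (left to right) and down each column, and strictly increasing along each diagonal $j-i=\mathrm{const}$; each $\mathcal T^{-1}(k)$ is then a skew diagram with no $2\times 2$ block. *)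

theory Defs
  imports "HOL-Analysis.Analysis" "Jordan_Normal_Form.Determinant"
begin

text \<open>Variables x = (x_1,x_2,...) and y = (y_1,y_2,...) are functions nat => complex;
  only indices >= 1 are used. The power sum p_k is sent to
  sum_i x_i^k + (-1)^(k-1) sum_j y_j^k.\<close>

definition pxy :: "(nat \<Rightarrow> complex) \<Rightarrow> (nat \<Rightarrow> complex) \<Rightarrow> nat \<Rightarrow> complex" where
  "pxy x y k = (\<Sum>i\<in>{i. 1 \<le> i \<and> x i \<noteq> 0}. x i ^ k)
             + (-1) ^ (k - 1) * (\<Sum>j\<in>{j. 1 \<le> j \<and> y j \<noteq> 0}. y j ^ k)"

text \<open>Image of the complete homogeneous function h_n under p_k |-> pxy x y k, obtained from
  the Newton identities n h_n = sum_{i=1}^n p_i h_{n-i}, h_0 = 1 (which express h_n in terms of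
  the generators p_k of Lambda).\<close>

function hxy :: "(nat \<Rightarrow> complex) \<Rightarrow> (nat \<Rightarrow> complex) \<Rightarrow> nat \<Rightarrow> complex" where
  "hxy x y n = (if n = 0 then 1
                else (\<Sum>i\<in>{1..n}. pxy x y i * hxy x y (n - i)) / of_nat n)"
  by pat_completeness auto
termination by (relation "Wellfounded.measure (\<lambda>(x, y, n). n)") auto

definition elem_seq :: "nat \<Rightarrow> nat \<Rightarrow> (int \<Rightarrow> complex) \<Rightarrow> complex" where
  "elem_seq m n a = (\<Sum>S\<in>{S. S \<subseteq> {1..n} \<and> card S = m}. \<Prod>i\<in>S. a (int i))"

definition shift_seq :: "int \<Rightarrow> (int \<Rightarrow> complex) \<Rightarrow> int \<Rightarrow> complex" where
  "shift_seq r a = (\<lambda>i. a (i + r))"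

definition hka :: "int \<Rightarrow> (int \<Rightarrow> complex) \<Rightarrow> (nat \<Rightarrow> complex) \<Rightarrow> (nat \<Rightarrow> complex) \<Rightarrow> complex" where
  "hka k a x y = (if k < 0 then 0 else if k = 0 then 1 else
      (\<Sum>i\<in>{1..nat k}. (-1) ^ (nat k - i) * elem_seq (nat k - i) (nat k - 1) a * hxy x y i))"

definition young_diagram :: "nat list \<Rightarrow> bool" where
  "young_diagram \<mu> \<longleftrightarrow> sorted_wrt (\<ge>) \<mu> \<and> (\<forall>m\<in>set \<mu>. 0 < m)"

definition part :: "nat list \<Rightarrow> nat \<Rightarrow> nat" where
  "part \<mu> i = (if 1 \<le> i \<and> i \<le> length \<mu> then \<mu> ! (i - 1) else 0)"

text \<open>s_{mu;a}(x;y) = det [h_{mu_i - i + j; tau^{1-j} a}]_{i,j=1..N} with N = length mu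
  (matrix indices of Jordan_Normal_Form are 0-based, hence the shifts by one).\<close>
definition schur_a :: "nat list \<Rightarrow> (int \<Rightarrow> complex) \<Rightarrow> (nat \<Rightarrow> complex) \<Rightarrow> (nat \<Rightarrow> complex) \<Rightarrow> complex" where
  "schur_a \<mu> a x y = det (mat (length \<mu>) (length \<mu>) (\<lambda>(i, j).
      hka (int (part \<mu> (i + 1)) - int (i + 1) + int (j + 1)) (shift_seq (1 - int (j + 1)) a) x y))"

definition boxes :: "nat list \<Rightarrow> (nat \<times> nat) set" where
  "boxes \<mu> = {(i, j). 1 \<le> i \<and> i \<le> length \<mu> \<and> 1 \<le> j \<and> j \<le> \<mu> ! (i - 1)}"

definition box_adj :: "nat \<times> nat \<Rightarrow> nat \<times> nat \<Rightarrow> bool" where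
  "box_adj b c \<longleftrightarrow> (fst b = fst c \<and> (snd c = snd b + 1 \<or> snd b = snd c + 1))
                  \<or> (snd b = snd c \<and> (fst c = fst b + 1 \<or> fst b = fst c + 1))"

definition adj_rel :: "(nat \<times> nat) set \<Rightarrow> ((nat \<times> nat) \<times> (nat \<times> nat)) set" where
  "adj_rel \<nu> = {(b, c). b \<in> \<nu> \<and> c \<in> \<nu> \<and> box_adj b c}"

definition components :: "(nat \<times> nat) set \<Rightarrow> (nat \<times> nat) set set" where
  "components \<nu> = (\<lambda>b. {c \<in> \<nu>. (b, c) \<in> (adj_rel \<nu>)\<^sup>*}) ` \<nu>"

text \<open>Polynomial of a skew hook C. The interior vertical side shared by boxes (i,j),(i,j+1)
  has midpoint (eps,delta) = (i-1/2, j), so a'_{delta-eps} = a_{j-i+1}; the interior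
  horizontal side shared by (i,j),(i+1,j) has midpoint (i, j-1/2), so a'_{delta-eps} = a_{j-i}.\<close>
definition f_hook :: "(int \<Rightarrow> complex) \<Rightarrow> (nat \<times> nat) set \<Rightarrow> complex \<Rightarrow> complex \<Rightarrow> complex" where
  "f_hook a C u v = (u + v)
     * (\<Prod>(i, j)\<in>{(i, j). (i, j) \<in> C \<and> (i, j + 1) \<in> C}. u - a (int j - int i + 1))
     * (\<Prod>(i, j)\<in>{(i, j). (i, j) \<in> C \<and> (i + 1, j) \<in> C}. v + a (int j - int i))"

definition f_skew :: "(int \<Rightarrow> complex) \<Rightarrow> (nat \<times> nat) set \<Rightarrow> complex \<Rightarrow> complex \<Rightarrow> complex" where
  "f_skew a \<nu> u v = (\<Prod>C\<in>components \<nu>. f_hook a C u v)"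

text \<open>A tableau is a map on boxes; to make it an honest function we set it 0 off the diagram.\<close>
definition diag_strict_tableau :: "nat list \<Rightarrow> (nat \<times> nat \<Rightarrow> nat) \<Rightarrow> bool" where
  "diag_strict_tableau \<mu> T \<longleftrightarrow>
     (\<forall>b. b \<notin> boxes \<mu> \<longrightarrow> T b = 0) \<and>
     (\<forall>b\<in>boxes \<mu>. 1 \<le> T b) \<and>
     (\<forall>i j. (i, j) \<in> boxes \<mu> \<and> (i, j + 1) \<in> boxes \<mu> \<longrightarrow> T (i, j) \<le> T (i, j + 1)) \<and>
     (\<forall>i j. (i, j) \<in> boxes \<mu> \<and> (i + 1, j) \<in> boxes \<mu> \<longrightarrow> T (i, j) \<le> T (i + 1, j)) \<and>
     (\<forall>i j. (i, j) \<in> boxes \<mu> \<and> (i + 1, j + 1) \<in> boxes \<mu> \<longrightarrow> T (i, j) < T (i + 1, j + 1))"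

end

theory Submission
  imports Defs
begin

text \<open>
  Adjoining one pair of variables \<open>u, v\<close> multiplies the generating series of the \<open>h\<^sub>k\<close> by
  \<open>(1 + v t) / (1 - u t)\<close>. Expanded in the basis \<open>h\<^bsub>k;a\<^esub>\<close>, this acts by a triangular kernel
  \<open>K(p, q)\<close> (with \<open>p = \<mu>\<^sub>i - i\<close>) which, thanks to the shifts \<open>\<tau>\<^bsup>1-j\<^esup>a\<close>, is the same in every column of
  the Jacobi-Trudi matrix. By Cauchy-Binet, \<open>s\<^bsub>\<mu>;a\<^esub>\<close> branches as the sum over \<open>\<nu>\<close> of
  \<open>det [K(\<mu>\<^sub>i - i, \<nu>\<^sub>j - j)]\<close> times \<open>s\<^bsub>\<nu>;a\<^esub>\<close>. Since \<open>K(p, q) / K(p', q)\<close> does not depend on \<open>q\<close> for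
  \<open>q < p' < p\<close>, subtracting from each row a multiple of the next one either produces a large zero block
  (if \<open>\<mu>/\<nu>\<close> is not a skew diagram without \<open>2 \<times> 2\<close> blocks) or a tridiagonal matrix in which opposite
  off-diagonal entries never both survive. Its determinant is then the product of its diagonal,
  whose \<open>i\<close>-th entry is the contribution of the \<open>i\<close>-th row to \<open>f\<^bsub>\<mu>/\<nu>;a\<^esub>\<close>. Peeling off the largest
  entry of a tableau gives the same recursion.
\<close>

section \<open>Determinants\<close>

text \<open>Pigeonhole: a permutation cannot map \<open>R\<close> into the complement of
  \<open>C\<close>, which has fewer than \<open>card R\<close> elements. So every Leibniz term
  contains an entry of the zero block.\<close>

lemma det_zero_block:
  fixes A :: "'a :: comm_ring_1 mat"
  assumes A: "A \<in> carrier_mat n n"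
    and R: "R \<subseteq> {0..<n}" and C: "C \<subseteq> {0..<n}" and card: "n < card R + card C"
    and zero: "\<And>i j. i \<in> R \<Longrightarrow> j \<in> C \<Longrightarrow> A $$ (i, j) = 0"
  shows "det A = 0"
proof -
  have "signof p * (\<Prod>i = 0..<n. A $$ (i, p i)) = 0" if p: "p permutes {0..<n}" for p
  proof -
    have "\<exists>i\<in>R. p i \<in> C"
    proof (rule ccontr)
      assume "\<not> (\<exists>i\<in>R. p i \<in> C)"
      moreover have "p ` R \<subseteq> {0..<n}" using permutes_image[OF p] R by blast
      ultimately have "p ` R \<subseteq> {0..<n} - C" by auto
      then have "card (p ` R) \<le> card ({0..<n} - C)" by (intro card_mono) auto
      moreover have "card (p ` R) = card R"
        using permutes_inj_on[OF p] by (rule card_image)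
      moreover have "card ({0..<n} - C) = n - card C"
        using C by (subst card_Diff_subset) (auto intro: finite_subset)
      moreover have "card C \<le> n" using card_mono[OF _ C] by simp
      ultimately show False using card by linarith
    qed
    then obtain i where i: "i \<in> R" "p i \<in> C" by blast
    then have "(\<Prod>i = 0..<n. A $$ (i, p i)) = 0"
      using R zero[OF i] by (intro prod_zero) auto
    then show ?thesis by simp
  qed
  then show ?thesis unfolding det_def'[OF A] by (intro sum.neutral) auto
qed

text \<open>For a permutation other than the identity let \<open>i\<close> be the least moved point.
  Both \<open>p i\<close> and the preimage of \<open>i\<close> exceed \<open>i\<close>, so a nonzero
  Leibniz term needs both to equal \<open>Suc i\<close>. It then contains both off-diagonal entries
  at \<open>i\<close>, one of which is zero.\<close>

lemma det_tridiagonal_diag: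
  fixes A :: "'a :: comm_ring_1 mat"
  assumes A: "A \<in> carrier_mat n n"
    and tri: "\<And>i j. i < n \<Longrightarrow> j < n \<Longrightarrow> i + 1 < j \<or> j + 1 < i \<Longrightarrow> A $$ (i, j) = 0"
    and off: "\<And>i. Suc i < n \<Longrightarrow> A $$ (i, Suc i) = 0 \<or> A $$ (Suc i, i) = 0"
  shows "det A = (\<Prod>i = 0..<n. A $$ (i, i))"
proof -
  have zero: "signof p * (\<Prod>i = 0..<n. A $$ (i, p i)) = 0"
    if p: "p permutes {0..<n}" and nid: "p \<noteq> id" for p
  proof -
    define i where "i = (LEAST i. p i \<noteq> i)"
    have ex: "\<exists>i. p i \<noteq> i" using nid by auto
    have pi: "p i \<noteq> i" unfolding i_def using LeastI_ex[OF ex] .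
    have below: "p k = k" if "k < i" for k
      using not_less_Least that unfolding i_def by blast
    have i: "i < n" using pi p by (metis permutes_not_in atLeastLessThan_iff zero_le)
    have inj: "inj p" using permutes_inj[OF p] .
    obtain j where j: "p j = i" using permutes_surj[OF p] by (metis surjD)
    have ji: "j > i" using below[of j] j pi by (metis linorder_neqE_nat)
    have jn: "j < n" using j i p by (metis permutes_not_in atLeastLessThan_iff zero_le)
    have pin: "p i < n" using p i permutes_in_image[OF p, of i] by auto
    have pig: "p i > i" using below[of "p i"] inj pi by (metis injD linorder_neqE_nat)
    have "A $$ (i, p i) = 0 \<or> A $$ (j, i) = 0"
      using tri[OF i pin] tri[OF jn i] off[of i] pig ji jn
      by (cases "p i = Suc i"; cases "j = Suc i") auto
    then have "(\<Prod>i = 0..<n. A $$ (i, p i)) = 0"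
    proof
      assume "A $$ (i, p i) = 0" then show ?thesis using i by (intro prod_zero) auto
    next
      assume "A $$ (j, i) = 0" then show ?thesis using jn j by (intro prod_zero) auto
    qed
    then show ?thesis by simp
  qed
  have "det A = (\<Sum>p\<in>{p. p permutes {0..<n}}. signof p * (\<Prod>i = 0..<n. A $$ (i, p i)))"
    by (rule det_def'[OF A])
  also have "\<dots> = (\<Sum>p\<in>{id}. signof p * (\<Prod>i = 0..<n. A $$ (i, p i)))"
    by (rule sum.mono_neutral_right) (auto simp: permutes_id finite_permutations zero)
  finally show ?thesis by simp
qed

text \<open>Each \<open>n\<close>-element subset of \<open>{0..<m}\<close> is encoded by its listing
  in decreasing order. This order matches the numbers \<open>\<nu> i + (n - Suc i)\<close> of a
  partition, which index the minors later.\<close>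

definition decreasing_maps :: "nat \<Rightarrow> nat \<Rightarrow> (nat \<Rightarrow> nat) set" where
  "decreasing_maps n m = {l \<in> {0..<n} \<rightarrow>\<^sub>E {0..<m}. \<forall>i j. i < j \<longrightarrow> j < n \<longrightarrow> l j < l i}"

lemma decreasing_maps_inj_on: "l \<in> decreasing_maps n m \<Longrightarrow> inj_on l {0..<n}"
  unfolding decreasing_maps_def inj_on_def
  by (smt (verit, ccfv_threshold) atLeastLessThan_iff linorder_neqE_nat mem_Collect_eq order_less_irrefl)

lemma decreasing_maps_index:
  assumes l: "l \<in> decreasing_maps n m" and i: "i < n"
  shows "card {z \<in> l ` {0..<n}. l i < z} = i"
proof -
  have dec: "l k < l j" if "j < k" "k < n" for j k
    using l that by (auto simp: decreasing_maps_def)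
  have "{z \<in> l ` {0..<n}. l i < z} = l ` {0..<i}"
  proof (intro equalityI subsetI)
    fix z assume "z \<in> {z \<in> l ` {0..<n}. l i < z}"
    then obtain k where k: "k < n" "z = l k" "l i < l k" by auto
    then have "k < i" using dec[of i k] by (metis linorder_neqE_nat less_asym)
    then show "z \<in> l ` {0..<i}" using k by auto
  qed (use dec i in auto)
  moreover have "inj_on l {0..<i}"
    using decreasing_maps_inj_on[OF l] by (rule inj_on_subset) (use i in auto)
  ultimately show ?thesis by (simp add: card_image)
qed

text \<open>\<open>l i\<close> is the element of the image with exactly \<open>i\<close> larger
  ones, so the image determines the map.\<close>

lemma decreasing_maps_image_inject:
  assumes l: "l \<in> decreasing_maps n m" and k: "k \<in> decreasing_maps n m"
    and eq: "l ` {0..<n} = k ` {0..<n}"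
  shows "l = k"
proof (rule PiE_ext)
  show "l \<in> {0..<n} \<rightarrow>\<^sub>E {0..<m}" "k \<in> {0..<n} \<rightarrow>\<^sub>E {0..<m}"
    using l k by (auto simp: decreasing_maps_def)
  fix i assume i: "i \<in> {0..<n}"
  then obtain j where j: "j < n" "l i = k j" using eq by (metis atLeastLessThan_iff imageE imageI)
  then have "i = j"
    using decreasing_maps_index[OF l, of i] decreasing_maps_index[OF k, of j] eq i by simp
  then show "l i = k i" using j by simp
qed

lemma decreasing_map_exists:
  assumes U: "U \<subseteq> {0..<m}" and c: "card U = n"
  obtains l where "l \<in> decreasing_maps n m" "l ` {0..<n} = U"
proof -
  have "finite U" using U finite_subset by blast
  then obtain h where h: "bij_betw h {..<n} U" "strict_mono_on {..<n} h"
    using ex_bij_betw_strict_mono_card[of U] c by metis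
  define l where "l = restrict (\<lambda>i. h (n - 1 - i)) {0..<n}"
  have "l ` {0..<n} = h ` ((\<lambda>i. n - 1 - i) ` {0..<n})"
    by (auto simp: l_def image_image)
  also have "(\<lambda>i. n - 1 - i) ` {0..<n} = {..<n}"
  proof -
    have "i \<in> (\<lambda>i. n - 1 - i) ` {0..<n}" if "i < n" for i
      using that by (intro image_eqI[of _ _ "n - 1 - i"]) auto
    then show ?thesis by auto
  qed
  also have "h ` {..<n} = U" using h by (simp add: bij_betw_def)
  finally have im: "l ` {0..<n} = U" .
  have "l j < l i" if "i < j" "j < n" for i j
    using that h(2) by (auto simp: l_def strict_mono_on_def)
  moreover have "l \<in> {0..<n} \<rightarrow>\<^sub>E {0..<m}"
  proof (intro PiE_I)
    fix i assume "i \<in> {0..<n}"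
    then show "l i \<in> {0..<m}" using im U by blast
  qed (simp add: l_def)
  ultimately have "l \<in> decreasing_maps n m" by (simp add: decreasing_maps_def)
  then show ?thesis using im that by blast
qed

text \<open>Sorting: an injective map is, in exactly one way, the decreasing listing of its image
  preceded by a permutation of the positions.\<close>

lemma bij_betw_decreasing_permutation:
  "bij_betw (\<lambda>(l, p). restrict (l \<circ> p) {0..<n})
     (decreasing_maps n m \<times> {p. p permutes {0..<n}})
     {f \<in> {0..<n} \<rightarrow>\<^sub>E {0..<m}. inj_on f {0..<n}}" (is "bij_betw ?h ?S ?F")
proof (rule bij_betw_imageI)
  have im: "restrict (l \<circ> p) {0..<n} ` {0..<n} = l ` {0..<n}" if "p permutes {0..<n}"
    for p and l :: "nat \<Rightarrow> nat"
  proof -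
    have "restrict (l \<circ> p) {0..<n} ` {0..<n} = l ` p ` {0..<n}" by (auto simp: image_image)
    then show ?thesis using permutes_image[OF that] by simp
  qed
  show "inj_on ?h ?S"
  proof (rule inj_onI, clarify)
    fix l p k q
    assume l: "l \<in> decreasing_maps n m" and p: "p permutes {0..<n}"
      and k: "k \<in> decreasing_maps n m" and q: "q permutes {0..<n}"
      and eq: "restrict (l \<circ> p) {0..<n} = restrict (k \<circ> q) {0..<n}"
    have lk: "l = k"
      using decreasing_maps_image_inject[OF l k] im[OF p, of l] im[OF q, of k] eq by simp
    have "p i = q i" for i
    proof (cases "i < n")
      case True
      then have "l (p i) = l (q i)" using fun_cong[OF eq, of i] lk by simp
      moreover have "p i \<in> {0..<n}" "q i \<in> {0..<n}"
        using True permutes_in_image[OF p, of i] permutes_in_image[OF q, of i] by auto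
      ultimately show ?thesis using decreasing_maps_inj_on[OF l] by (auto dest: inj_onD)
    next
      case False
      then show ?thesis using permutes_not_in[OF p, of i] permutes_not_in[OF q, of i] by simp
    qed
    then show "l = k \<and> p = q" using lk by auto
  qed
  show "?h ` ?S = ?F"
  proof (intro equalityI subsetI)
    fix f assume "f \<in> ?h ` ?S"
    then obtain l p where f: "f = restrict (l \<circ> p) {0..<n}"
      and l: "l \<in> decreasing_maps n m" and p: "p permutes {0..<n}" by auto
    have "inj_on (l \<circ> p) {0..<n}"
      using decreasing_maps_inj_on[OF l] permutes_inj_on[OF p] permutes_image[OF p]
      by (intro comp_inj_on) auto
    then have "inj_on f {0..<n}" unfolding f by (simp add: inj_on_restrict_eq)
    moreover have "f i < m" if "i < n" for i
      using that permutes_in_image[OF p, of i] l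
      by (auto simp: f decreasing_maps_def PiE_iff)
    ultimately show "f \<in> ?F" by (auto simp: f)
  next
    fix f assume f: "f \<in> ?F"
    then have sub: "f ` {0..<n} \<subseteq> {0..<m}" and inj: "inj_on f {0..<n}" by auto
    obtain l where l: "l \<in> decreasing_maps n m" and lim: "l ` {0..<n} = f ` {0..<n}"
      using decreasing_map_exists[OF sub] card_image[OF inj] by (metis card_atLeastLessThan diff_zero)
    have bl: "bij_betw l {0..<n} (f ` {0..<n})"
      using decreasing_maps_inj_on[OF l] lim by (simp add: bij_betw_def)
    have bf: "bij_betw f {0..<n} (f ` {0..<n})" using inj by (simp add: bij_betw_def)
    \<comment> \<open>\<open>p i\<close> is the place of \<open>f i\<close> in the decreasing
      listing \<open>l\<close>.\<close>
    define p where "p = (\<lambda>i. if i \<in> {0..<n} then inv_into {0..<n} l (f i) else i)"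
    have "bij_betw (inv_into {0..<n} l \<circ> f) {0..<n} {0..<n}"
      using bij_betw_trans[OF bf bij_betw_inv_into[OF bl]] .
    then have "bij_betw p {0..<n} {0..<n}"
      by (rule iffD1[OF bij_betw_cong, rotated]) (simp add: p_def)
    then have p: "p permutes {0..<n}"
      by (rule bij_imp_permutes) (simp add: p_def)
    have "restrict (l \<circ> p) {0..<n} = f"
    proof
      fix i show "restrict (l \<circ> p) {0..<n} i = f i"
        using f lim by (cases "i < n") (auto simp: p_def f_inv_into_f PiE_def extensional_def)
    qed
    then show "f \<in> ?h ` ?S" using l p by force
  qed
qed

text \<open>Expanding every row as a sum over \<open>k\<close> turns the determinant into a sum over
  all maps \<open>f\<close> from rows to \<open>{0..<m}\<close>. Maps that are not injective give a
  matrix with two equal rows. The others are grouped by their image, and the permutations sorting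
  them rebuild the minors of \<open>A\<close>.\<close>

lemma cauchy_binet:
  fixes A B :: "nat \<Rightarrow> nat \<Rightarrow> 'a :: comm_ring_1"
  shows "det (mat n n (\<lambda>(i, j). \<Sum>k\<in>{0..<m}. A i k * B k j))
       = (\<Sum>l\<in>decreasing_maps n m. det (mat n n (\<lambda>(i, j). A i (l j))) * det (mat n n (\<lambda>(i, j). B (l i) j)))"
proof -
  let ?P = "{p. p permutes {0..<n}}" and ?E = "{0..<n} \<rightarrow>\<^sub>E {0..<m}"
  let ?g = "\<lambda>f. (\<Prod>i = 0..<n. A i (f i)) * det (mat n n (\<lambda>(i, j). B (f i) j))"
  have perm_lt: "p i < n" if "p permutes {0..<n}" "i < n" for p i
    using permutes_in_image[OF that(1), of i] that(2) by simp
  have "det (mat n n (\<lambda>(i, j). \<Sum>k\<in>{0..<m}. A i k * B k j))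
     = (\<Sum>p\<in>?P. signof p * (\<Prod>i = 0..<n. \<Sum>k\<in>{0..<m}. A i k * B k (p i)))"
    by (subst det_def'[of _ n]) (auto intro!: sum.cong prod.cong simp: perm_lt)
  also have "\<dots> = (\<Sum>p\<in>?P. \<Sum>f\<in>?E. (\<Prod>i = 0..<n. A i (f i)) * (signof p * (\<Prod>i = 0..<n. B (f i) (p i))))"
    by (subst prod_sum_PiE) (auto simp: prod.distrib sum_distrib_left mult_ac)
  also have "\<dots> = (\<Sum>f\<in>?E. \<Sum>p\<in>?P. (\<Prod>i = 0..<n. A i (f i)) * (signof p * (\<Prod>i = 0..<n. B (f i) (p i))))"
    by (rule sum.swap)
  also have "\<dots> = (\<Sum>f\<in>?E. ?g f)"
    by (intro sum.cong refl, subst det_def'[of _ n])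
       (auto intro!: sum.cong prod.cong simp: perm_lt sum_distrib_left)
  also have "\<dots> = (\<Sum>f\<in>{f \<in> ?E. inj_on f {0..<n}}. ?g f)"
  proof (rule sum.mono_neutral_right)
    show "\<forall>f\<in>?E - {f \<in> ?E. inj_on f {0..<n}}. ?g f = 0"
    proof
      fix f assume "f \<in> ?E - {f \<in> ?E. inj_on f {0..<n}}"
      then obtain i j where ij: "i < n" "j < n" "i \<noteq> j" "f i = f j"
        by (auto simp: inj_on_def)
      have "det (mat n n (\<lambda>(i, j). B (f i) j)) = 0"
        by (rule det_identical_rows[of _ n i j]) (use ij in \<open>auto intro!: eq_vecI\<close>)
      then show "?g f = 0" by simp
    qed
  qed (auto intro: finite_PiE)
  also have "\<dots> = (\<Sum>(l, p)\<in>decreasing_maps n m \<times> ?P. ?g (restrict (l \<circ> p) {0..<n}))"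
    using sum.reindex_bij_betw[OF bij_betw_decreasing_permutation[of n m], of ?g]
    by (simp add: case_prod_unfold)
  also have "\<dots> = (\<Sum>l\<in>decreasing_maps n m. \<Sum>p\<in>?P. ?g (restrict (l \<circ> p) {0..<n}))"
    by (rule sum.cartesian_product[symmetric])
  also have "\<dots> = (\<Sum>l\<in>decreasing_maps n m. det (mat n n (\<lambda>(i, j). A i (l j))) * det (mat n n (\<lambda>(i, j). B (l i) j)))"
  proof (intro sum.cong refl)
    fix l
    \<comment> \<open>Undoing \<open>p\<close> on the rows of the minor of \<open>B\<close> costs
      exactly the sign that the Leibniz sum for the minor of \<open>A\<close> requires.\<close>
    have "?g (restrict (l \<circ> p) {0..<n})
        = (signof p * (\<Prod>i = 0..<n. A i (l (p i)))) * det (mat n n (\<lambda>(i, j). B (l i) j))"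
      if p: "p permutes {0..<n}" for p
    proof -
      have "mat n n (\<lambda>(i, j). B (restrict (l \<circ> p) {0..<n} i) j)
          = mat n n (\<lambda>(i, j). mat n n (\<lambda>(i, j). B (l i) j) $$ (p i, j))"
        by (rule eq_matI) (auto simp: perm_lt[OF p])
      then show ?thesis
        using det_permute_rows[OF _ p, of "mat n n (\<lambda>(i, j). B (l i) j)"] by (simp add: mult_ac)
    qed
    then have "(\<Sum>p\<in>?P. ?g (restrict (l \<circ> p) {0..<n}))
        = (\<Sum>p\<in>?P. signof p * (\<Prod>i = 0..<n. A i (l (p i)))) * det (mat n n (\<lambda>(i, j). B (l i) j))"
      by (simp add: sum_distrib_right)
    also have "(\<Sum>p\<in>?P. signof p * (\<Prod>i = 0..<n. A i (l (p i)))) = det (mat n n (\<lambda>(i, j). A i (l j)))"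
      by (subst det_def'[of _ n]) (auto intro!: sum.cong prod.cong simp: perm_lt)
    finally show "(\<Sum>p\<in>?P. ?g (restrict (l \<circ> p) {0..<n}))
        = det (mat n n (\<lambda>(i, j). A i (l j))) * det (mat n n (\<lambda>(i, j). B (l i) j))" .
  qed
  finally show ?thesis .
qed

section \<open>Complete homogeneous functions\<close>

lemma hxy_0 [simp]: "hxy x y 0 = 1"
  by (subst hxy.simps) simp

declare hxy.simps [simp del]

lemma hxy_Suc: "of_nat (Suc n) * hxy x y (Suc n) = (\<Sum>i = 0..n. pxy x y (Suc i) * hxy x y (n - i))"
proof -
  have "of_nat (Suc n) * hxy x y (Suc n) = (\<Sum>i\<in>{Suc 0..Suc n}. pxy x y i * hxy x y (Suc n - i))"
    by (subst hxy.simps) (simp del: of_nat_Suc)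
  also have "\<dots> = (\<Sum>i = 0..n. pxy x y (Suc i) * hxy x y (n - i))"
    by (subst sum.shift_bounds_cl_Suc_ivl) simp
  finally show ?thesis .
qed

lemma fps_deriv_hxy:
  "fps_deriv (Abs_fps (hxy x y)) = Abs_fps (\<lambda>n. pxy x y (Suc n)) * Abs_fps (hxy x y)"
  by (rule fps_ext) (use hxy_Suc[of _ x y] in \<open>simp add: fps_mult_nth\<close>)

text \<open>Read coefficientwise, the differential equation is the Newton recursion. With constant
  term 1 it has a single solution, since \<open>Suc k\<close> is invertible.\<close>

lemma fps_eq_hxy:
  assumes "fps_nth F 0 = 1" and "fps_deriv F = Abs_fps (\<lambda>n. pxy x y (Suc n)) * F"
  shows "F = Abs_fps (hxy x y)"
proof (rule fps_ext)
  fix n show "fps_nth F n = fps_nth (Abs_fps (hxy x y)) n"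
  proof (induction n rule: less_induct)
    case (less n)
    show ?case
    proof (cases n)
      case (Suc k)
      have "of_nat (Suc k) * fps_nth F (Suc k) = fps_nth (Abs_fps (\<lambda>n. pxy x y (Suc n)) * F) k"
        unfolding assms(2)[symmetric] by simp
      also have "\<dots> = (\<Sum>i = 0..k. pxy x y (Suc i) * fps_nth F (k - i))"
        by (simp add: fps_mult_nth)
      also have "\<dots> = (\<Sum>i = 0..k. pxy x y (Suc i) * hxy x y (k - i))"
        using less.IH Suc by (intro sum.cong refl) simp
      also have "\<dots> = of_nat (Suc k) * hxy x y (Suc k)" by (rule hxy_Suc[symmetric])
      finally show ?thesis using Suc by (simp del: of_nat_Suc)
    qed (simp add: assms(1))
  qed
qed

lemma hxy_cong:
  assumes "\<And>k. k \<ge> 1 \<Longrightarrow> pxy x y k = pxy x' y' k"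
  shows "hxy x y n = hxy x' y' n"
proof -
  have "Abs_fps (hxy x y) = Abs_fps (hxy x' y')"
    by (rule fps_eq_hxy) (use fps_deriv_hxy[of x y] assms in simp_all)
  then show ?thesis by (metis fps_nth_Abs_fps)
qed

text \<open>The conclusion is a coefficient of \<open>U * G = V * H\<close>, where \<open>H\<close>
  and \<open>G\<close> are the old and the new series. To identify \<open>G\<close>, defined as
  \<open>V * H / U\<close>, with the new series, it is shown to satisfy the characterizing
  differential equation: its logarithmic derivative gains
  \<open>u / (1 - u t) + v / (1 + v t)\<close>, which is the change of the power sums.\<close>

lemma hxy_adjoin:
  assumes p: "\<And>k. k \<ge> 1 \<Longrightarrow> pxy x' y' k = pxy x y k + u ^ k + (-1) ^ (k - 1) * v ^ k"
  shows "hxy x' y' (Suc n) = u * hxy x' y' n + hxy x y (Suc n) + v * hxy x y n"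
proof -
  define U V :: "complex fps" where "U = 1 - fps_const u * fps_X" and "V = 1 + fps_const v * fps_X"
  define P P' where "P = Abs_fps (\<lambda>n. pxy x y (Suc n))" and "P' = Abs_fps (\<lambda>n. pxy x' y' (Suc n))"
  define H where "H = Abs_fps (hxy x y)"
  define G where "G = V * H * inverse U"
  have U0: "fps_nth U 0 = 1" and V0: "fps_nth V 0 = 1" by (simp_all add: U_def V_def)
  have nz: "U \<noteq> 0" "V \<noteq> 0" using U0 V0 by auto
  have UG: "U * G = V * H" unfolding G_def using inverse_mult_eq_1'[of U] U0 by (simp add: mult_ac)
  have geoU: "U * Abs_fps (\<lambda>n. u ^ Suc n) = fps_const u"
  proof (rule fps_ext)
    fix n show "fps_nth (U * Abs_fps (\<lambda>n. u ^ Suc n)) n = fps_nth (fps_const u) n"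
      by (cases n) (simp_all add: U_def left_diff_distrib mult.assoc)
  qed
  have geoV: "V * Abs_fps (\<lambda>n. (-1) ^ n * v ^ Suc n) = fps_const v"
  proof (rule fps_ext)
    fix n show "fps_nth (V * Abs_fps (\<lambda>n. (-1) ^ n * v ^ Suc n)) n = fps_nth (fps_const v) n"
      by (cases n) (simp_all add: V_def distrib_right mult.assoc)
  qed
  have "P' = P + Abs_fps (\<lambda>n. u ^ Suc n) + Abs_fps (\<lambda>n. (-1) ^ n * v ^ Suc n)"
    unfolding P_def P'_def by (rule fps_ext) (simp add: p)
  then have "U * V * P' = U * V * P + V * (U * Abs_fps (\<lambda>n. u ^ Suc n)) + U * (V * Abs_fps (\<lambda>n. (-1) ^ n * v ^ Suc n))"
    by (simp add: algebra_simps)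
  then have UVP: "U * V * P' = U * V * P + V * fps_const u + U * fps_const v"
    unfolding geoU geoV .
  have dU: "fps_deriv U = - fps_const u" and dV: "fps_deriv V = fps_const v"
    by (simp_all add: U_def V_def)
  have dH: "fps_deriv H = P * H" unfolding H_def P_def by (rule fps_deriv_hxy)
  have "fps_deriv (U * G) = fps_deriv (V * H)" using UG by simp
  then have d: "U * fps_deriv G = fps_const u * G + fps_const v * H + V * P * H"
    by (simp add: dU dV dH algebra_simps del: fps_const_neg)
  \<comment> \<open>Multiplying by \<open>U * V\<close> keeps inverse series out of the computation;
    \<open>nz\<close> cancels this factor at the end.\<close>
  have "U * V * fps_deriv G = V * (U * fps_deriv G)" by (simp add: mult_ac)
  also have "\<dots> = V * fps_const u * G + (fps_const v + V * P) * (V * H)"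
    unfolding d by (simp add: algebra_simps)
  also have "\<dots> = (U * V * P + V * fps_const u + U * fps_const v) * G"
    unfolding UG[symmetric] by (simp add: algebra_simps)
  also have "\<dots> = U * V * (P' * G)" unfolding UVP[symmetric] by (simp add: mult_ac)
  finally have "fps_deriv G = P' * G" using nz by simp
  moreover have "fps_nth G 0 = 1"
    using arg_cong[OF UG, of "\<lambda>F. fps_nth F 0"] U0 V0 by (simp add: H_def)
  ultimately have "G = Abs_fps (hxy x' y')" unfolding P'_def by (intro fps_eq_hxy)
  then have "fps_nth (U * Abs_fps (hxy x' y')) (Suc n) = fps_nth (V * H) (Suc n)" using UG by simp
  then show ?thesis
    by (simp add: U_def V_def H_def ring_distribs mult.assoc algebra_simps)
qed

text \<open>The value on \<open>t^s (t - a\<^sub>1) \<dots> (t - a\<^sub>n)\<close> of the linear functional \<open>t^i \<mapsto> h\<^sub>i\<close>.\<close>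

definition hfun :: "(int \<Rightarrow> complex) \<Rightarrow> (nat \<Rightarrow> complex) \<Rightarrow> nat \<Rightarrow> nat \<Rightarrow> complex" where
  "hfun a h n s = (\<Sum>B\<in>Pow {1..n}. (\<Prod>i\<in>B. - a (int i)) * h (s + (n - card B)))"

lemma hfun_0 [simp]: "hfun a h 0 s = h s"
  by (simp add: hfun_def)

text \<open>The argument of the functional is multiplied by \<open>t - a (Suc n)\<close>: the
  subsets are split according to whether they contain \<open>Suc n\<close>.\<close>

lemma hfun_Suc: "hfun a h (Suc n) s = hfun a h n (Suc s) - a (int (Suc n)) * hfun a h n s"
proof -
  have eq: "{1..Suc n} = insert (Suc n) {1..n}" by auto
  have inj: "inj_on (insert (Suc n)) (Pow {1..n})"
    by (rule inj_onI) (metis PowD Suc_n_not_le_n atLeastAtMost_iff insert_ident subsetD)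
  have "hfun a h (Suc n) s = (\<Sum>B\<in>Pow {1..n}. (\<Prod>i\<in>B. - a (int i)) * h (s + (Suc n - card B)))
     + (\<Sum>B\<in>Pow {1..n}. (\<Prod>i\<in>insert (Suc n) B. - a (int i)) * h (s + (Suc n - card (insert (Suc n) B))))"
    unfolding hfun_def eq Pow_insert
    by (subst sum.union_disjoint) (auto simp: sum.reindex[OF inj, simplified])
  also have "(\<Sum>B\<in>Pow {1..n}. (\<Prod>i\<in>B. - a (int i)) * h (s + (Suc n - card B))) = hfun a h n (Suc s)"
    unfolding hfun_def
  proof (intro sum.cong refl)
    fix B assume "B \<in> Pow {1..n}"
    then have "card B \<le> n" using card_mono[of "{1..n}" B] by simp
    then show "(\<Prod>i\<in>B. - a (int i)) * h (s + (Suc n - card B)) = (\<Prod>i\<in>B. - a (int i)) * h (Suc s + (n - card B))"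
      by (simp add: Suc_diff_le)
  qed
  also have "(\<Sum>B\<in>Pow {1..n}. (\<Prod>i\<in>insert (Suc n) B. - a (int i)) * h (s + (Suc n - card (insert (Suc n) B))))
     = - a (int (Suc n)) * hfun a h n s"
    unfolding hfun_def sum_distrib_left
  proof (intro sum.cong refl)
    fix B assume "B \<in> Pow {1..n}"
    then have "finite B" "Suc n \<notin> B" by (auto intro: finite_subset)
    then show "(\<Prod>i\<in>insert (Suc n) B. - a (int i)) * h (s + (Suc n - card (insert (Suc n) B)))
        = - a (int (Suc n)) * ((\<Prod>i\<in>B. - a (int i)) * h (s + (n - card B)))"
      by simp
  qed
  finally show ?thesis by simp
qed

text \<open>Expanding \<open>t (t - a 1) ... (t - a n)\<close> and collecting the subsets of equal
  size gives the elementary symmetric polynomials with their signs.\<close>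

lemma hka_eq_hfun: "hka (int (Suc n)) a x y = hfun a (hxy x y) n 1"
proof -
  let ?t = "\<lambda>B. (\<Prod>i\<in>B. - a (int i)) * hxy x y (1 + (n - card B))"
  have "hfun a (hxy x y) n 1 = (\<Sum>c\<in>{0..n}. \<Sum>B\<in>{B \<in> Pow {1..n}. card B = c}. ?t B)"
    unfolding hfun_def
    by (rule sum.group[symmetric]) (auto dest: card_mono[rotated])
  also have "\<dots> = (\<Sum>c\<in>{0..n}. (-1) ^ c * elem_seq c n a * hxy x y (1 + (n - c)))"
  proof (rule sum.cong)
    fix c
    have "(\<Sum>B\<in>{B \<in> Pow {1..n}. card B = c}. ?t B)
       = (\<Sum>B\<in>{B. B \<subseteq> {1..n} \<and> card B = c}. (-1) ^ c * (\<Prod>i\<in>B. a (int i)) * hxy x y (1 + (n - c)))"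
      by (intro sum.cong) (auto simp: prod_uminus)
    then show "(\<Sum>B\<in>{B \<in> Pow {1..n}. card B = c}. ?t B) = (-1) ^ c * elem_seq c n a * hxy x y (1 + (n - c))"
      by (simp add: elem_seq_def sum_distrib_left sum_distrib_right)
  qed simp
  also have "\<dots> = (\<Sum>i\<in>{1..Suc n}. (-1) ^ (Suc n - i) * elem_seq (Suc n - i) n a * hxy x y i)"
    by (rule sum.reindex_bij_witness[of _ "\<lambda>i. Suc n - i" "\<lambda>c. Suc n - c"]) (auto simp: Suc_diff_le)
  finally show ?thesis by (simp add: hka_def nat_add_distrib)
qed

text \<open>For positive \<open>k\<close> this combines \<open>hfun_Suc\<close>, used for both sets
  of variables, with the recursion \<open>h\<close> carried through the functional. The identity
  holds for all integers: below -1 both sides vanish, at -1 both are 1, and at 0 the two occurrences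
  of \<open>a 0\<close> cancel.\<close>

lemma hka_adjoin:
  assumes h: "\<And>n. hxy x' y' (Suc n) = u * hxy x' y' n + hxy x y (Suc n) + v * hxy x y n"
  shows "hka (k + 1) a x' y' = (u - a k) * hka k a x' y' + (v + a k) * hka k a x y + hka (k + 1) a x y"
proof -
  have shift: "hfun a (hxy x' y') n (Suc s)
      = u * hfun a (hxy x' y') n s + hfun a (hxy x y) n (Suc s) + v * hfun a (hxy x y) n s" for n s
    unfolding hfun_def by (simp add: h sum_distrib_left sum.distrib algebra_simps)
  consider "k < -1" | "k = -1" | "k = 0" | n where "k = int (Suc n)"
  proof (cases "k > 0")
    case True
    then show thesis using that(4)[of "nat (k - 1)"] by simp
  next
    case False
    then have "k < -1 \<or> k = -1 \<or> k = 0" by linarith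
    then show thesis using that by blast
  qed
  then show ?thesis
  proof cases
    case 3
    then show ?thesis using hka_eq_hfun[of 0 a x' y'] hka_eq_hfun[of 0 a x y] h[of 0]
      by (simp add: hka_def[of 0])
  next
    case 4
    have k1: "k + 1 = int (Suc (Suc n))" using 4 by simp
    show ?thesis
      unfolding k1 unfolding 4 hka_eq_hfun hfun_Suc shift[of n 1]
      by (simp add: algebra_simps)
  qed (simp_all add: hka_def)
qed

section \<open>The branching kernel\<close>

text \<open>The coefficients that iterating \<open>hka_adjoin\<close> produces. At
  \<open>p = q + 1\<close> the contributions \<open>u - a (q + 1)\<close> and
  \<open>v + a (q + 1)\<close> add up to \<open>u + v\<close>, which is why the product starts at
  \<open>q + 2\<close>.\<close>

definition branch_ker :: "(int \<Rightarrow> complex) \<Rightarrow> complex \<Rightarrow> complex \<Rightarrow> int \<Rightarrow> int \<Rightarrow> complex" where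
  "branch_ker a u v p q = (if p < q then 0 else if p = q then 1 else (u + v) * (\<Prod>r\<in>{q + 2..p}. u - a r))"

lemma branch_ker_step:
  "branch_ker a u v (p + 1) q = (u - a (p + 1)) * branch_ker a u v p q
     + (if q = p then v + a (p + 1) else 0) + (if q = p + 1 then 1 else 0)"
proof (cases "q < p")
  case True
  then have "{q + 2..p + 1} = insert (p + 1) {q + 2..p}" by auto
  then show ?thesis using True by (simp add: branch_ker_def)
qed (auto simp: branch_ker_def)

text \<open>Entry in row \<open>p\<close>, column \<open>q\<close> after subtracting a multiple of the next row \<open>p'\<close>.\<close>

definition reduced_ker :: "(int \<Rightarrow> complex) \<Rightarrow> complex \<Rightarrow> complex \<Rightarrow> int \<Rightarrow> int \<Rightarrow> int \<Rightarrow> complex" where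
  "reduced_ker a u v p p' q =
     (if q < p' then 0 else if q = p' then (v + a (q + 1)) * (\<Prod>r\<in>{q + 2..p}. u - a r)
      else branch_ker a u v p q)"

text \<open>Left of \<open>p'\<close> the product for row \<open>p\<close> factors at
  \<open>p'\<close>, so the two terms cancel. At \<open>q = p'\<close> the difference
  \<open>(u + v) - (u - a (q + 1))\<close> leaves \<open>v + a (q + 1)\<close>. Right of
  \<open>p'\<close> the subtracted row is zero.\<close>

lemma branch_ker_row_operation:
  assumes "p' < p"
  shows "branch_ker a u v p q - (\<Prod>r\<in>{p' + 1..p}. u - a r) * branch_ker a u v p' q
       = reduced_ker a u v p p' q"
proof -
  consider "q < p'" | "q = p'" | "q > p'" by linarith
  then show ?thesis
  proof cases
    case 1
    have "{q + 2..p} = {q + 2..p'} \<union> {p' + 1..p}" using 1 assms by auto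
    then have "(\<Prod>r\<in>{q + 2..p}. u - a r) = (\<Prod>r\<in>{q + 2..p'}. u - a r) * (\<Prod>r\<in>{p' + 1..p}. u - a r)"
      by (simp add: prod.union_disjoint)
    then show ?thesis using 1 assms by (simp add: branch_ker_def reduced_ker_def)
  next
    case 2
    have "{q + 1..p} = insert (q + 1) {q + 2..p}" using 2 assms by auto
    then have "(\<Prod>r\<in>{q + 1..p}. u - a r) = (u - a (q + 1)) * (\<Prod>r\<in>{q + 2..p}. u - a r)"
      by simp
    then show ?thesis using 2 assms by (simp add: branch_ker_def reduced_ker_def algebra_simps)
  next
    case 3
    then show ?thesis by (simp add: branch_ker_def reduced_ker_def)
  qed
qed

section \<open>Determinants of the branching kernel for decreasing index sequences\<close>

context
  fixes a :: "int \<Rightarrow> complex" and u v :: complex and p q :: "nat \<Rightarrow> int" and n :: nat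
  assumes p: "\<And>i j. i < j \<Longrightarrow> p j < p i" and q: "\<And>i j. i < j \<Longrightarrow> q j < q i"
    and pq: "\<And>j. j < n \<Longrightarrow> p n < q j"
begin

text \<open>Left multiplication by the unipotent bidiagonal matrix \<open>R\<close> performs all the
  row operations at once.\<close>

lemma det_branch_ker_reduce:
  "det (mat n n (\<lambda>(i, j). branch_ker a u v (p i) (q j)))
     = det (mat n n (\<lambda>(i, j). reduced_ker a u v (p i) (p (Suc i)) (q j)))"
proof -
  define c where "c i = (\<Prod>r\<in>{p (Suc i) + 1..p i}. u - a r)" for i
  define R where "R = mat n n (\<lambda>(i, j). if j = i then 1 else if j = Suc i then - c i else 0)"
  let ?K = "mat n n (\<lambda>(i, j). branch_ker a u v (p i) (q j))"
  have "R * ?K = mat n n (\<lambda>(i, j). reduced_ker a u v (p i) (p (Suc i)) (q j))"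
  proof (rule eq_matI)
    fix i j
    assume "i < dim_row (mat n n (\<lambda>(i, j). reduced_ker a u v (p i) (p (Suc i)) (q j)))"
      and "j < dim_col (mat n n (\<lambda>(i, j). reduced_ker a u v (p i) (p (Suc i)) (q j)))"
    then have i: "i < n" and j: "j < n" by simp_all
    have "(R * ?K) $$ (i, j)
        = (\<Sum>k\<in>{0..<n}. (if k = i then 1 else if k = Suc i then - c i else 0) * branch_ker a u v (p k) (q j))"
      using i j by (simp add: R_def scalar_prod_def)
    also have "\<dots> = (\<Sum>k\<in>{0..<n}. (if k = i then branch_ker a u v (p i) (q j) else 0)
        + (if k = Suc i then - c i * branch_ker a u v (p (Suc i)) (q j) else 0))"
      by (intro sum.cong) auto
    also have "\<dots> = branch_ker a u v (p i) (q j)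
        + (if Suc i < n then - c i * branch_ker a u v (p (Suc i)) (q j) else 0)"
      using i by (simp add: sum.distrib)
    also have "\<dots> = branch_ker a u v (p i) (q j) - c i * branch_ker a u v (p (Suc i)) (q j)"
    proof (cases "Suc i < n")
      case False
      \<comment> \<open>The last row has no successor in the matrix, but the kernel row of
        \<open>p n\<close> is zero in all columns by \<open>pq\<close>, so the same formula
        applies.\<close>
      then have "Suc i = n" using i by simp
      then show ?thesis using pq[OF j] by (simp add: branch_ker_def)
    qed simp
    also have "\<dots> = reduced_ker a u v (p i) (p (Suc i)) (q j)"
      unfolding c_def by (rule branch_ker_row_operation) (simp add: p)
    finally show "(R * ?K) $$ (i, j) = mat n n (\<lambda>(i, j). reduced_ker a u v (p i) (p (Suc i)) (q j)) $$ (i, j)"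
      using i j by simp
  qed (simp_all add: R_def)
  moreover have "det R = 1"
  proof -
    have "det R = prod_list (diag_mat R)"
      by (rule det_upper_triangular[of _ n]) (auto simp: R_def upper_triangular_def)
    also have "\<dots> = 1" by (simp add: prod_list_diag_prod R_def)
    finally show ?thesis .
  qed
  moreover have "det (R * ?K) = det R * det ?K"
    by (rule det_mult[of _ n]) (simp_all add: R_def)
  ultimately show ?thesis by simp
qed

text \<open>The \<open>n - i\<close> rows from \<open>i\<close> on vanish in the first
  \<open>i + 1\<close> columns.\<close>

lemma det_branch_ker_not_contained:
  assumes i: "i < n" "p i < q i"
  shows "det (mat n n (\<lambda>(i, j). branch_ker a u v (p i) (q j))) = 0"
proof (rule det_zero_block[of _ n "{i..<n}" "{0..i}"])
  fix k l assume kl: "k \<in> {i..<n}" "l \<in> {0..i}"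
  have "p k \<le> p i" using p[of i k] kl by (cases "k = i") auto
  moreover have "q i \<le> q l" using q[of l i] kl by (cases "l = i") auto
  ultimately show "mat n n (\<lambda>(i, j). branch_ker a u v (p i) (q j)) $$ (k, l) = 0"
    using kl i by (simp add: branch_ker_def)
qed (use i in auto)

text \<open>The row reduction creates the zero block: the first \<open>i + 1\<close> rows vanish in
  the \<open>n - i\<close> columns from \<open>i\<close> on.\<close>

lemma det_branch_ker_block:
  assumes i: "i < n" "q i < p (Suc i)"
  shows "det (mat n n (\<lambda>(i, j). branch_ker a u v (p i) (q j))) = 0"
  unfolding det_branch_ker_reduce
proof (rule det_zero_block[of _ n "{0..i}" "{i..<n}"])
  fix k l assume kl: "k \<in> {0..i}" "l \<in> {i..<n}"
  have "p (Suc i) \<le> p (Suc k)" using p[of "Suc k" "Suc i"] kl by (cases "k = i") auto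
  moreover have "q l \<le> q i" using q[of i l] kl by (cases "l = i") auto
  ultimately show "mat n n (\<lambda>(i, j). reduced_ker a u v (p i) (p (Suc i)) (q j)) $$ (k, l) = 0"
    using kl i by (simp add: reduced_ker_def)
qed (use i in auto)

text \<open>Interlacing leaves only the three central diagonals of the reduced matrix. Entry
  \<open>(i, Suc i)\<close> can survive only for \<open>q (Suc i) = p (Suc i)\<close>, and then
  \<open>p (Suc i) < q i\<close> kills entry \<open>(Suc i, i)\<close>.\<close>

lemma det_branch_ker_hook:
  assumes le: "\<And>i. i < n \<Longrightarrow> q i \<le> p i" and hook: "\<And>i. i < n \<Longrightarrow> p (Suc i) \<le> q i"
  shows "det (mat n n (\<lambda>(i, j). branch_ker a u v (p i) (q j)))
       = (\<Prod>i = 0..<n. reduced_ker a u v (p i) (p (Suc i)) (q i))"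
proof -
  let ?B = "mat n n (\<lambda>(i, j). reduced_ker a u v (p i) (p (Suc i)) (q j))"
  have "det ?B = (\<Prod>i = 0..<n. ?B $$ (i, i))"
  proof (rule det_tridiagonal_diag)
    fix i j assume ij: "i < n" "j < n" and far: "i + 1 < j \<or> j + 1 < i"
    from far show "?B $$ (i, j) = 0"
    proof
      assume "i + 1 < j"
      then have "q j < p (Suc i)" using q[of "Suc i" j] le[of "Suc i"] ij by force
      then show ?thesis using ij by (simp add: reduced_ker_def)
    next
      assume "j + 1 < i"
      then have "p i < q j" using p[of "Suc j" i] hook[of j] ij by force
      moreover have "p (Suc i) < p i" by (simp add: p)
      ultimately show ?thesis using ij by (simp add: reduced_ker_def branch_ker_def)
    qed
  next
    fix i assume i: "Suc i < n"
    show "?B $$ (i, Suc i) = 0 \<or> ?B $$ (Suc i, i) = 0"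
    proof (cases "q (Suc i) < p (Suc i)")
      case True
      then show ?thesis using i by (simp add: reduced_ker_def)
    next
      case False
      then have "p (Suc i) < q i" using q[of i "Suc i"] le[of "Suc i"] i by simp
      moreover have "p (Suc (Suc i)) < p (Suc i)" by (simp add: p)
      ultimately show ?thesis using i by (simp add: reduced_ker_def branch_ker_def)
    qed
  qed simp
  then show ?thesis by (simp add: det_branch_ker_reduce)
qed

end

section \<open>Branching of the determinants\<close>

text \<open>Rows of a shape are numbered from 0, those of boxes from 1; so \<open>pos \<nu> i\<close> is the
  \<open>\<nu>\<^sub>i - i\<close> of the 1-based numbering.\<close>

definition shapes :: "nat \<Rightarrow> nat \<Rightarrow> (nat \<Rightarrow> nat) set" where
  "shapes n m = {\<nu>. antimono \<nu> \<and> (\<forall>i\<ge>n. \<nu> i = 0) \<and> \<nu> 0 \<le> m}"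

definition pos :: "(nat \<Rightarrow> nat) \<Rightarrow> nat \<Rightarrow> int" where
  "pos \<nu> i = int (\<nu> i) - int i - 1"

lemma shapes_bound: "\<nu> \<in> shapes n m \<Longrightarrow> \<nu> i \<le> m"
  unfolding shapes_def by (auto dest: antimonoD[of _ 0 i])

lemma pos_decreasing: "antimono \<nu> \<Longrightarrow> i < j \<Longrightarrow> pos \<nu> j < pos \<nu> i"
  unfolding pos_def by (auto dest: antimonoD[of _ i j])

text \<open>Adding the staircase \<open>n - Suc i\<close> makes a partition strictly decreasing, so
  the index sets of Cauchy-Binet become shapes. The bound \<open>\<nu> 0 \<le> m\<close> corresponds
  to values below \<open>n + m\<close>.\<close>

lemma bij_betw_shapes_decreasing_maps:
  "bij_betw (\<lambda>\<nu>. restrict (\<lambda>i. \<nu> i + (n - Suc i)) {0..<n}) (shapes n m) (decreasing_maps n (n + m))"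
    (is "bij_betw ?h _ _")
proof (rule bij_betw_imageI)
  show "inj_on ?h (shapes n m)"
  proof (rule inj_onI, rule ext)
    fix \<nu> \<kappa> i
    assume *: "\<nu> \<in> shapes n m" "\<kappa> \<in> shapes n m" and eq: "?h \<nu> = ?h \<kappa>"
    show "\<nu> i = \<kappa> i" using fun_cong[OF eq, of i] * by (cases "i < n") (auto simp: shapes_def)
  qed
  show "?h ` shapes n m = decreasing_maps n (n + m)"
  proof (intro equalityI subsetI)
    fix l assume "l \<in> ?h ` shapes n m"
    then obtain \<nu> where \<nu>: "\<nu> \<in> shapes n m" and l: "l = ?h \<nu>" by blast
    have "l i < n + m" if "i < n" for i
      using shapes_bound[OF \<nu>, of i] that by (simp add: l)
    moreover have "l j < l i" if "i < j" "j < n" for i j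
      using \<nu> antimonoD[of \<nu> i j] that by (simp add: l shapes_def)
    ultimately show "l \<in> decreasing_maps n (n + m)"
      unfolding decreasing_maps_def by (auto simp: l)
  next
    fix l assume l: "l \<in> decreasing_maps n (n + m)"
    then have dec: "\<And>i j. i < j \<Longrightarrow> j < n \<Longrightarrow> l j < l i" and bound: "\<And>i. i < n \<Longrightarrow> l i < n + m"
      and ext: "\<And>i. \<not> i < n \<Longrightarrow> l i = undefined"
      by (auto simp: decreasing_maps_def PiE_iff extensional_def)
    \<comment> \<open>A strictly decreasing listing stays above the staircase, so the natural-number
      subtraction below is exact.\<close>
    have ge: "d < n \<Longrightarrow> d \<le> l (n - 1 - d)" for d
    proof (induction d)
      case (Suc d)
      have "l (n - 1 - d) < l (n - 1 - Suc d)" by (rule dec) (use Suc.prems in auto)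
      then show ?case using Suc by linarith
    qed simp
    define \<nu> where "\<nu> i = (if i < n then l i - (n - Suc i) else 0)" for i
    have "decseq \<nu>"
    proof (rule decseq_SucI)
      fix i show "\<nu> (Suc i) \<le> \<nu> i"
        using dec[of i "Suc i"] by (auto simp: \<nu>_def)
    qed
    moreover have "\<nu> 0 \<le> m" using bound[of 0] by (auto simp: \<nu>_def)
    ultimately have "\<nu> \<in> shapes n m" by (auto simp: shapes_def \<nu>_def)
    moreover have "?h \<nu> = l"
    proof
      fix i show "?h \<nu> i = l i"
        using ge[of "n - Suc i"] ext[of i] by (cases "i < n") (auto simp: \<nu>_def)
    qed
    ultimately show "l \<in> ?h ` shapes n m" by blast
  qed
qed

lemma hka_neg [simp]: "k < 0 \<Longrightarrow> hka k a x y = 0"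
  by (simp add: hka_def)

text \<open>The Jacobi-Trudi determinant with rows and columns counted from 0, so the shift
  \<open>1 - j\<close> becomes \<open>- j\<close>. The size \<open>n\<close> stays fixed while the
  shape shrinks, with zero parts as padding.\<close>

definition hdet :: "nat \<Rightarrow> (int \<Rightarrow> complex) \<Rightarrow> (nat \<Rightarrow> complex) \<Rightarrow> (nat \<Rightarrow> complex) \<Rightarrow> (nat \<Rightarrow> nat) \<Rightarrow> complex" where
  "hdet n a x y \<nu> = det (mat n n (\<lambda>(i, j). hka (pos \<nu> i + 1 + int j) (shift_seq (- int j) a) x y))"

context
  fixes x y x' y' :: "nat \<Rightarrow> complex" and u v :: complex
  assumes h: "\<And>n. hxy x' y' (Suc n) = u * hxy x' y' n + hxy x y (Suc n) + v * hxy x y n"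
begin

text \<open>Induction on \<open>l\<close> with \<open>hka_adjoin\<close>. The sequence shifted by
  \<open>- int j\<close> is read at an index shifted by \<open>int j\<close>, so \<open>j\<close>
  drops out of the coefficients and one kernel serves all columns.\<close>

lemma hka_branch:
  assumes j: "j < n" and l: "l < m"
  shows "hka (int l - int n + 1 + int j) (shift_seq (- int j) a) x' y'
    = (\<Sum>k\<in>{0..<m}. branch_ker a u v (int l - int n) (int k - int n)
         * hka (int k - int n + 1 + int j) (shift_seq (- int j) a) x y)"
  using l
proof (induction l)
  case 0
  let ?\<phi> = "\<lambda>k. hka (int k - int n + 1 + int j) (shift_seq (- int j) a) x y"
  \<comment> \<open>The index is at most 0 because \<open>j < n\<close>, and there the two sets of
    variables give the same value.\<close>
  have "hka (int 0 - int n + 1 + int j) (shift_seq (- int j) a) x' y' = ?\<phi> 0"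
    using hka_adjoin[OF h, of "int j - int n" "shift_seq (- int j) a"] j
    by (simp add: algebra_simps)
  also have "\<dots> = (\<Sum>k\<in>{0..<m}. if k = 0 then ?\<phi> 0 else 0)" using 0 by simp
  also have "\<dots> = (\<Sum>k\<in>{0..<m}. branch_ker a u v (int 0 - int n) (int k - int n) * ?\<phi> k)"
    by (intro sum.cong) (auto simp: branch_ker_def)
  finally show ?case .
next
  case (Suc l)
  let ?\<phi> = "\<lambda>k. hka (int k - int n + 1 + int j) (shift_seq (- int j) a) x y"
  let ?p = "int l - int n"
  have "(\<Sum>k\<in>{0..<m}. branch_ker a u v (?p + 1) (int k - int n) * ?\<phi> k)
    = (\<Sum>k\<in>{0..<m}. (u - a (?p + 1)) * (branch_ker a u v ?p (int k - int n) * ?\<phi> k)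
        + (if k = l then (v + a (?p + 1)) * ?\<phi> l else 0) + (if k = Suc l then ?\<phi> (Suc l) else 0))"
    by (intro sum.cong refl, subst branch_ker_step) (auto simp: algebra_simps)
  also have "\<dots> = (u - a (?p + 1)) * (\<Sum>k\<in>{0..<m}. branch_ker a u v ?p (int k - int n) * ?\<phi> k)
        + (v + a (?p + 1)) * ?\<phi> l + ?\<phi> (Suc l)"
    using Suc.prems by (simp add: sum.distrib sum_distrib_left)
  also have "(\<Sum>k\<in>{0..<m}. branch_ker a u v ?p (int k - int n) * ?\<phi> k)
      = hka (?p + 1 + int j) (shift_seq (- int j) a) x' y'"
    using Suc by simp
  also have "(u - a (?p + 1)) * hka (?p + 1 + int j) (shift_seq (- int j) a) x' y' + (v + a (?p + 1)) * ?\<phi> l + ?\<phi> (Suc l)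
      = hka (?p + 1 + int j + 1) (shift_seq (- int j) a) x' y'"
    using hka_adjoin[OF h, of "?p + 1 + int j" "shift_seq (- int j) a"]
    by (simp add: shift_seq_def algebra_simps)
  finally show ?case by (simp add: algebra_simps)
qed

text \<open>\<open>hka_branch\<close> writes the matrix as a product, and Cauchy-Binet sums over the
  intermediate shapes. Raising the positions by \<open>n\<close> makes them natural numbers.\<close>

lemma hdet_branch:
  assumes \<mu>: "\<mu> \<in> shapes n m"
  shows "hdet n a x' y' \<mu> = (\<Sum>\<nu>\<in>shapes n m.
     det (mat n n (\<lambda>(i, j). branch_ker a u v (pos \<mu> i) (pos \<nu> j))) * hdet n a x y \<nu>)"
proof -
  let ?\<phi> = "\<lambda>k j. hka (int k - int n + 1 + int j) (shift_seq (- int j) a) x y"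
  let ?h = "\<lambda>\<nu>. restrict (\<lambda>i. \<nu> i + (n - Suc i)) {0..<n}"
  have hpos: "int (?h \<nu> i) - int n = pos \<nu> i" if "i < n" for \<nu> i
    using that by (simp add: pos_def)
  have bound: "?h \<mu> i < n + m" if "i < n" for i
    using that shapes_bound[OF \<mu>, of i] by simp
  have "mat n n (\<lambda>(i, j). hka (pos \<mu> i + 1 + int j) (shift_seq (- int j) a) x' y')
      = mat n n (\<lambda>(i, j). \<Sum>k\<in>{0..<n + m}. branch_ker a u v (pos \<mu> i) (int k - int n) * ?\<phi> k j)"
  proof (rule eq_matI, goal_cases)
    case (1 i j)
    then have i: "i < n" and j: "j < n" by simp_all
    show ?case using hka_branch[OF j bound[OF i], of a] i j unfolding hpos[OF i] by simp
  qed simp_all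
  then have "hdet n a x' y' \<mu> = (\<Sum>l\<in>decreasing_maps n (n + m).
      det (mat n n (\<lambda>(i, j). branch_ker a u v (pos \<mu> i) (int (l j) - int n)))
      * det (mat n n (\<lambda>(i, j). ?\<phi> (l i) j)))"
    unfolding hdet_def by (simp only: cauchy_binet)
  also have "\<dots> = (\<Sum>\<nu>\<in>shapes n m.
      det (mat n n (\<lambda>(i, j). branch_ker a u v (pos \<mu> i) (int (?h \<nu> j) - int n)))
      * det (mat n n (\<lambda>(i, j). ?\<phi> (?h \<nu> i) j)))"
    by (rule sum.reindex_bij_betw[OF bij_betw_shapes_decreasing_maps, symmetric])
  also have "\<dots> = (\<Sum>\<nu>\<in>shapes n m.
     det (mat n n (\<lambda>(i, j). branch_ker a u v (pos \<mu> i) (pos \<nu> j))) * hdet n a x y \<nu>)"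
  proof (intro sum.cong refl arg_cong2[where f = "(*)"])
    fix \<nu>
    show "det (mat n n (\<lambda>(i, j). branch_ker a u v (pos \<mu> i) (int (?h \<nu> j) - int n)))
       = det (mat n n (\<lambda>(i, j). branch_ker a u v (pos \<mu> i) (pos \<nu> j)))"
      by (rule arg_cong[where f = det], rule cong_mat) (simp_all add: hpos del: restrict_apply)
    show "det (mat n n (\<lambda>(i, j). ?\<phi> (?h \<nu> i) j)) = hdet n a x y \<nu>"
      unfolding hdet_def
      by (rule arg_cong[where f = det], rule cong_mat) (simp_all add: hpos del: restrict_apply)
  qed
  finally show ?thesis .
qed

end

section \<open>Polynomials of skew hooks\<close>

definition component_of :: "(nat \<times> nat) set \<Rightarrow> nat \<times> nat \<Rightarrow> (nat \<times> nat) set" where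
  "component_of S b = {c \<in> S. (b, c) \<in> (adj_rel S)\<^sup>*}"

lemma components_eq: "components S = component_of S ` S"
  by (simp add: components_def component_of_def)

lemma finite_components: "finite S \<Longrightarrow> finite (components S)"
  by (simp add: components_eq)

lemma sym_adj_rel: "sym (adj_rel S)"
  by (auto simp: sym_def adj_rel_def box_adj_def)

lemma component_of_eq:
  assumes "(b, c) \<in> (adj_rel S)\<^sup>*" shows "component_of S b = component_of S c"
proof -
  have "(c, b) \<in> (adj_rel S)\<^sup>*" using symD[OF sym_rtrancl[OF sym_adj_rel] assms] .
  then show ?thesis using assms unfolding component_of_def by (auto intro: rtrancl_trans)
qed

lemma component_subset: "C \<in> components S \<Longrightarrow> C \<subseteq> S"
  by (auto simp: components_eq component_of_def)

lemma component_adjacent: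
  assumes "C \<in> components S" "b \<in> C" "c \<in> S" "box_adj b c"
  shows "c \<in> C"
proof -
  obtain d where d: "C = component_of S d" using assms(1) by (auto simp: components_eq)
  have "(b, c) \<in> adj_rel S"
    using assms component_subset[OF assms(1)] by (auto simp: adj_rel_def)
  then show ?thesis using assms(2,3) unfolding d component_of_def
    by (auto intro: rtrancl_into_rtrancl)
qed

lemma components_disjoint:
  assumes "C \<in> components S" "D \<in> components S" "C \<noteq> D" shows "C \<inter> D = {}"
proof -
  obtain b c where "C = component_of S b" "D = component_of S c"
    using assms by (auto simp: components_eq)
  then show ?thesis using assms(3) component_of_eq[of b _ S] component_of_eq[of c _ S]
    unfolding component_of_def[of S b] component_of_def[of S c]
    by (smt (verit, ccfv_threshold) disjoint_iff mem_Collect_eq component_of_def)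
qed

lemma component_exists: "b \<in> S \<Longrightarrow> \<exists>C\<in>components S. b \<in> C"
  by (auto simp: components_eq component_of_def)

text \<open>Two neighbouring boxes of \<open>S\<close> lie in the same component, so every interior
  side belongs to exactly one component. This is meant for \<open>nxt\<close> the right or the lower
  neighbour.\<close>

lemma prod_components:
  fixes g :: "nat \<times> nat \<Rightarrow> 'a :: comm_monoid_mult"
  assumes S: "finite S" and adj: "\<And>b. box_adj b (nxt b)"
  shows "(\<Prod>C\<in>components S. \<Prod>b\<in>{b \<in> C. nxt b \<in> C}. g b) = (\<Prod>b\<in>{b \<in> S. nxt b \<in> S}. g b)"
proof -
  have "(\<Prod>C\<in>components S. \<Prod>b\<in>{b \<in> C. nxt b \<in> C}. g b)
      = prod g (\<Union>C\<in>components S. {b \<in> C. nxt b \<in> C})"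
  proof (rule prod.UNION_disjoint[symmetric])
    show "\<forall>C\<in>components S. finite {b \<in> C. nxt b \<in> C}"
      using S component_subset by (metis finite_Collect_conjI finite_subset Collect_mem_eq)
    show "\<forall>C\<in>components S. \<forall>D\<in>components S. C \<noteq> D \<longrightarrow> {b \<in> C. nxt b \<in> C} \<inter> {b \<in> D. nxt b \<in> D} = {}"
      using components_disjoint by blast
  qed (simp add: finite_components S)
  also have "(\<Union>C\<in>components S. {b \<in> C. nxt b \<in> C}) = {b \<in> S. nxt b \<in> S}"
  proof (intro equalityI subsetI)
    fix b assume b: "b \<in> {b \<in> S. nxt b \<in> S}"
    then obtain C where "C \<in> components S" "b \<in> C" using component_exists[of b S] by auto
    then show "b \<in> (\<Union>C\<in>components S. {b \<in> C. nxt b \<in> C})"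
      using component_adjacent[of C S b "nxt b"] adj b by auto
  qed (use component_subset in blast)
  finally show ?thesis .
qed

lemma f_skew_eq:
  assumes S: "finite S"
  shows "f_skew a S u v = (u + v) ^ card (components S)
     * (\<Prod>(i, j)\<in>{(i, j). (i, j) \<in> S \<and> (i, j + 1) \<in> S}. u - a (int j - int i + 1))
     * (\<Prod>(i, j)\<in>{(i, j). (i, j) \<in> S \<and> (i + 1, j) \<in> S}. v + a (int j - int i))"
proof -
  have V: "{(i, j). (i, j) \<in> C \<and> (i, j + 1) \<in> C} = {b \<in> C. (fst b, snd b + 1) \<in> C}"
    and H: "{(i, j). (i, j) \<in> C \<and> (i + 1, j) \<in> C} = {b \<in> C. (fst b + 1, snd b) \<in> C}"
    for C :: "(nat \<times> nat) set" by auto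
  show ?thesis
    unfolding f_skew_def f_hook_def V H prod.distrib
    by (subst (1 2) prod_components[OF S]) (simp_all add: box_adj_def)
qed

lemma f_skew_empty [simp]: "f_skew a {} u v = 1"
  by (simp add: f_skew_def components_def)

text \<open>A nonempty set has a component, and its factor \<open>u + v\<close> is zero. This kills
  all tableaux with a label whose two variables vanish.\<close>

lemma f_skew_zero:
  assumes "finite S" "S \<noteq> {}" shows "f_skew a S 0 0 = 0"
  using assms by (simp add: f_skew_eq components_eq card_gt_0_iff)

definition diagram :: "(nat \<Rightarrow> nat) \<Rightarrow> (nat \<times> nat) set" where
  "diagram \<nu> = {(i, j). 1 \<le> i \<and> 1 \<le> j \<and> j \<le> \<nu> (i - 1)}"

lemma mem_diagram_Suc [simp]: "(Suc i, j) \<in> diagram \<nu> \<longleftrightarrow> 1 \<le> j \<and> j \<le> \<nu> i"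
  by (simp add: diagram_def)

lemma not_mem_diagram_0 [simp]: "(0, j) \<notin> diagram \<nu>" "(i, 0) \<notin> diagram \<nu>"
  by (simp_all add: diagram_def)

lemma finite_diagram:
  assumes "\<nu> \<in> shapes n m" shows "finite (diagram \<nu>)"
proof -
  have "diagram \<nu> \<subseteq> {0..n} \<times> {0..m}"
  proof
    fix b assume b: "b \<in> diagram \<nu>"
    obtain i j where ij: "b = (i, j)" by fastforce
    have "\<nu> (i - 1) \<noteq> 0" using b by (auto simp: ij diagram_def)
    then have "i - 1 < n" using assms by (metis (mono_tags, lifting) shapes_def mem_Collect_eq not_le)
    then show "b \<in> {0..n} \<times> {0..m}"
      using b shapes_bound[OF assms, of "i - 1"] by (auto simp: ij diagram_def)
  qed
  then show ?thesis by (rule finite_subset) simp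
qed

section \<open>Skew shapes without 2 x 2 blocks, analysed row by row\<close>

context
  fixes \<mu> \<nu> :: "nat \<Rightarrow> nat" and n m :: nat
  assumes \<mu>: "\<mu> \<in> shapes n m" and \<nu>: "\<nu> \<in> shapes n m"
    \<comment> \<open>A 2 x 2 block in rows \<open>i\<close> and \<open>Suc i\<close> would need
      \<open>\<nu> i + 2 \<le> \<mu> (Suc i)\<close>, which \<open>hook\<close> excludes.\<close>
    and sub: "\<And>i. \<nu> i \<le> \<mu> i" and hook: "\<And>i. \<mu> (Suc i) \<le> \<nu> i + 1"
begin

lemma mem_skew: "(Suc i, j) \<in> diagram \<mu> - diagram \<nu> \<longleftrightarrow> \<nu> i < j \<and> j \<le> \<mu> i"
  by auto

lemma skew_row_lt: "\<nu> i < \<mu> i \<Longrightarrow> i < n"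
  using \<mu> unfolding shapes_def by (metis (mono_tags, lifting) mem_Collect_eq not_le not_less_zero)

lemma mu_Suc_le: "\<mu> (Suc i) \<le> \<mu> i" and nu_Suc_le: "\<nu> (Suc i) \<le> \<nu> i"
  using \<mu> \<nu> by (auto simp: shapes_def antimono_def)

text \<open>A component is determined by the leftmost box of its bottom row; such a row \<open>i\<close> is not
  linked to the next one, which happens exactly if \<open>\<mu> (Suc i) \<noteq> \<nu> i + 1\<close>.\<close>

lemma skew_connected_left:
  assumes "\<nu> i < j" "j \<le> \<mu> i"
  shows "((Suc i, j), (Suc i, Suc (\<nu> i))) \<in> (adj_rel (diagram \<mu> - diagram \<nu>))\<^sup>*"
  using assms
proof (induction j)
  case (Suc j)
  show ?case
  proof (cases "j = \<nu> i")
    case False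
    then have "((Suc i, Suc j), (Suc i, j)) \<in> adj_rel (diagram \<mu> - diagram \<nu>)"
      using Suc.prems by (auto simp: adj_rel_def box_adj_def)
    then show ?thesis using Suc False by (auto intro: converse_rtrancl_into_rtrancl)
  qed simp
qed simp

text \<open>Go left to the beginning of the row, step down if the next row is linked, and repeat.
  Rows from \<open>n\<close> on are empty, so the walk stops.\<close>

lemma skew_connected_bottom:
  assumes "\<nu> i < j" "j \<le> \<mu> i"
  shows "\<exists>k. \<nu> k < \<mu> k \<and> \<mu> (Suc k) \<noteq> \<nu> k + 1 \<and>
     ((Suc i, j), (Suc k, Suc (\<nu> k))) \<in> (adj_rel (diagram \<mu> - diagram \<nu>))\<^sup>*"
  using assms
proof (induction "n - i" arbitrary: i j rule: less_induct)
  case less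
  have i: "\<nu> i < \<mu> i" using less.prems by simp
  note left = skew_connected_left[OF less.prems]
  show ?case
  proof (cases "\<mu> (Suc i) = \<nu> i + 1")
    case True
    then have j: "\<nu> (Suc i) < Suc (\<nu> i)" "Suc (\<nu> i) \<le> \<mu> (Suc i)" using nu_Suc_le[of i] by auto
    have "n - Suc i < n - i" using skew_row_lt[OF i] by simp
    from less.hyps[OF this j] obtain k where k: "\<nu> k < \<mu> k" "\<mu> (Suc k) \<noteq> \<nu> k + 1"
      "((Suc (Suc i), Suc (\<nu> i)), (Suc k, Suc (\<nu> k))) \<in> (adj_rel (diagram \<mu> - diagram \<nu>))\<^sup>*" by blast
    have "((Suc i, Suc (\<nu> i)), (Suc (Suc i), Suc (\<nu> i))) \<in> adj_rel (diagram \<mu> - diagram \<nu>)"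
      using i j by (auto simp: adj_rel_def box_adj_def)
    then have "((Suc i, j), (Suc k, Suc (\<nu> k))) \<in> (adj_rel (diagram \<mu> - diagram \<nu>))\<^sup>*"
      using left k(3) by (meson rtrancl.rtrancl_into_rtrancl rtrancl_trans)
    then show ?thesis using k by blast
  next
    case False
    then show ?thesis using i left by blast
  qed
qed

text \<open>A path could leave row \<open>k\<close> downwards only in a column \<open>c\<close> with
  \<open>\<nu> k < c\<close> and \<open>c \<le> \<mu> (Suc k)\<close>; by \<open>hook\<close> this
  forces \<open>\<mu> (Suc k) = \<nu> k + 1\<close>.\<close>

lemma skew_connected_row_le:
  assumes "\<mu> (Suc k) \<noteq> \<nu> k + 1" "((Suc k, j), c) \<in> (adj_rel (diagram \<mu> - diagram \<nu>))\<^sup>*"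
  shows "fst c \<le> Suc k"
  using assms(2)
proof (induction rule: rtrancl_induct)
  case (step b c)
  show ?case
  proof (rule ccontr)
    assume "\<not> fst c \<le> Suc k"
    then have "fst b = Suc k" "fst c = Suc (Suc k)" "snd b = snd c"
      using step by (auto simp: adj_rel_def box_adj_def)
    moreover have "b \<in> diagram \<mu> - diagram \<nu>" "c \<in> diagram \<mu> - diagram \<nu>"
      using step by (auto simp: adj_rel_def)
    ultimately have "\<nu> k < snd c" "snd c \<le> \<mu> (Suc k)"
      by (metis mem_skew prod.collapse)+
    then show False using hook[of k] assms(1) by simp
  qed
qed simp

lemma card_components_skew:
  "card (components (diagram \<mu> - diagram \<nu>)) = card {i \<in> {0..<n}. \<nu> i < \<mu> i \<and> \<mu> (Suc i) \<noteq> \<nu> i + 1}"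
proof -
  let ?S = "diagram \<mu> - diagram \<nu>" and ?I = "{i \<in> {0..<n}. \<nu> i < \<mu> i \<and> \<mu> (Suc i) \<noteq> \<nu> i + 1}"
  let ?C = "\<lambda>i. component_of ?S (Suc i, Suc (\<nu> i))"
  have "components ?S = ?C ` ?I"
  proof (intro equalityI subsetI)
    fix C assume "C \<in> components ?S"
    then obtain b where b: "b \<in> ?S" "C = component_of ?S b" by (auto simp: components_eq)
    obtain i j where ij: "b = (Suc i, j)" using b(1)
      by (metis Diff_iff not0_implies_Suc not_mem_diagram_0(1) prod.collapse)
    have "\<nu> i < j" "j \<le> \<mu> i" using b(1) unfolding ij mem_skew by auto
    then obtain k where k: "\<nu> k < \<mu> k" "\<mu> (Suc k) \<noteq> \<nu> k + 1"
      "(b, (Suc k, Suc (\<nu> k))) \<in> (adj_rel ?S)\<^sup>*"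
      using skew_connected_bottom[of i j] unfolding ij by blast
    then show "C \<in> ?C ` ?I"
      using component_of_eq[OF k(3)] b(2) skew_row_lt[OF k(1)] by auto
  next
    fix C assume "C \<in> ?C ` ?I"
    then show "C \<in> components ?S" by (auto simp: components_eq)
  qed
  moreover have "inj_on ?C ?I"
  proof (rule inj_onI)
    fix i k assume i: "i \<in> ?I" and k: "k \<in> ?I" and eq: "?C i = ?C k"
    have "(Suc k, Suc (\<nu> k)) \<in> ?C k" "(Suc i, Suc (\<nu> i)) \<in> ?C i"
      using i k unfolding component_of_def by auto
    then have "(Suc k, Suc (\<nu> k)) \<in> ?C i" "(Suc i, Suc (\<nu> i)) \<in> ?C k"
      unfolding eq by blast+
    then have ik: "((Suc i, Suc (\<nu> i)), (Suc k, Suc (\<nu> k))) \<in> (adj_rel ?S)\<^sup>*"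
      and ki: "((Suc k, Suc (\<nu> k)), (Suc i, Suc (\<nu> i))) \<in> (adj_rel ?S)\<^sup>*"
      by (simp_all only: component_of_def mem_Collect_eq)
    \<comment> \<open>Neither path goes below the row in which it starts, so the two rows
      coincide.\<close>
    show "i = k"
      using skew_connected_row_le[OF _ ik] skew_connected_row_le[OF _ ki] i k by simp
  qed
  ultimately show ?thesis by (simp add: card_image)
qed

lemma prod_skew_vertical:
  fixes g :: "nat \<times> nat \<Rightarrow> complex"
  shows "(\<Prod>b\<in>{(i, j). (i, j) \<in> diagram \<mu> - diagram \<nu> \<and> (i, j + 1) \<in> diagram \<mu> - diagram \<nu>}. g b)
    = (\<Prod>i = 0..<n. \<Prod>j\<in>{\<nu> i + 1..<\<mu> i}. g (Suc i, j))" (is "prod g ?V = _")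
proof -
  have "(\<Prod>i = 0..<n. \<Prod>j\<in>{\<nu> i + 1..<\<mu> i}. g (Suc i, j))
      = (\<Prod>(i, j)\<in>(SIGMA i:{0..<n}. {\<nu> i + 1..<\<mu> i}). g (Suc i, j))"
    by (subst prod.Sigma) auto
  also have "\<dots> = prod g ?V"
  proof (rule prod.reindex_bij_witness[of _ "\<lambda>(i, j). (i - 1, j)" "\<lambda>(i, j). (Suc i, j)"], goal_cases)
    case (4 b)
    then obtain i j where b: "b = (Suc i, j)" by (cases b; cases "fst b") auto
    then have "\<nu> i < \<mu> i" using 4 by auto
    then show ?case using 4 skew_row_lt[of i] b by auto
  next
    case (3 b)
    then show ?case by (cases b; cases "fst b") auto
  qed auto
  finally show ?thesis by simp
qed

text \<open>By \<open>hook\<close>, consecutive rows overlap in at most one column, namely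
  \<open>\<nu> i + 1\<close>, so each pair of rows contributes at most one horizontal side.\<close>

lemma prod_skew_horizontal:
  fixes g :: "nat \<times> nat \<Rightarrow> complex"
  shows "(\<Prod>b\<in>{(i, j). (i, j) \<in> diagram \<mu> - diagram \<nu> \<and> (i + 1, j) \<in> diagram \<mu> - diagram \<nu>}. g b)
    = (\<Prod>i = 0..<n. if \<mu> (Suc i) = \<nu> i + 1 then g (Suc i, \<nu> i + 1) else 1)" (is "prod g ?H = _")
proof -
  have "(\<Prod>i = 0..<n. if \<mu> (Suc i) = \<nu> i + 1 then g (Suc i, \<nu> i + 1) else 1)
      = (\<Prod>i\<in>{i \<in> {0..<n}. \<mu> (Suc i) = \<nu> i + 1}. g (Suc i, \<nu> i + 1))"
    by (rule prod.inter_filter[symmetric]) simp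
  also have "\<dots> = prod g ?H"
  proof (rule prod.reindex_bij_witness[of _ "\<lambda>(i, j). i - 1" "\<lambda>i. (Suc i, \<nu> i + 1)"], goal_cases)
    case (2 i)
    then show ?case using mu_Suc_le[of i] nu_Suc_le[of i] by auto
  next
    case (3 b)
    then obtain i j where b: "b = (Suc i, j)" by (cases b; cases "fst b") auto
    then have "\<nu> i < j" "j \<le> \<mu> (Suc i)" using 3 by auto
    then show ?case using hook[of i] b by auto
  next
    case (4 b)
    then obtain i j where b: "b = (Suc i, j)" by (cases b; cases "fst b") auto
    then have "\<nu> i < j" "j \<le> \<mu> (Suc i)" using 4 by auto
    then show ?case using hook[of i] b mu_Suc_le[of i] skew_row_lt[of i] by auto
  qed auto
  finally show ?thesis by simp
qed

text \<open>Every factor is assigned to a row: its vertical sides, the horizontal side linking it to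
  the next row, and one \<open>u + v\<close> for the bottom row of each component. This matches the
  cases of \<open>reduced_ker\<close>: an empty row gives 1, a linked row the entry at
  \<open>q = p'\<close>, and a bottom row the kernel itself.\<close>

lemma f_skew_diagram:
  "f_skew a (diagram \<mu> - diagram \<nu>) u v
     = (\<Prod>i = 0..<n. reduced_ker a u v (pos \<mu> i) (pos \<mu> (Suc i)) (pos \<nu> i))"
proof -
  let ?tail = "\<lambda>i. \<nu> i < \<mu> i \<and> \<mu> (Suc i) \<noteq> \<nu> i + 1"
  have tails: "(u + v) ^ card {i \<in> {0..<n}. ?tail i} = (\<Prod>i = 0..<n. if ?tail i then u + v else 1)"
    by (simp add: prod.inter_filter[symmetric])
  have row: "(if ?tail i then u + v else 1) * (\<Prod>j\<in>{\<nu> i + 1..<\<mu> i}. u - a (int j - int (Suc i) + 1))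
      * (if \<mu> (Suc i) = \<nu> i + 1 then v + a (int (\<nu> i + 1) - int (Suc i)) else 1)
      = reduced_ker a u v (pos \<mu> i) (pos \<mu> (Suc i)) (pos \<nu> i)" for i
  proof -
    \<comment> \<open>With \<open>r = j - i\<close>, column \<open>\<nu> i + 1\<close> corresponds
      to \<open>pos \<nu> i + 2\<close>.\<close>
    have "(\<Prod>j\<in>{\<nu> i + 1..<\<mu> i}. u - a (int j - int (Suc i) + 1)) = (\<Prod>r\<in>{pos \<nu> i + 2..pos \<mu> i}. u - a r)"
      by (rule prod.reindex_bij_witness[of _ "\<lambda>r. nat (r + int i)" "\<lambda>j. int j - int i"])
         (auto simp: pos_def)
    moreover have "int (\<nu> i + 1) - int (Suc i) = pos \<nu> i + 1" by (simp add: pos_def)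
    moreover have "pos \<nu> i = pos \<mu> (Suc i) \<longleftrightarrow> \<mu> (Suc i) = \<nu> i + 1"
      "\<not> pos \<nu> i < pos \<mu> (Suc i)" "\<not> pos \<mu> i < pos \<nu> i" "pos \<mu> i = pos \<nu> i \<longleftrightarrow> \<not> \<nu> i < \<mu> i"
      using hook[of i] sub[of i] by (auto simp: pos_def)
    moreover have "(\<Prod>r\<in>{pos \<nu> i + 2..pos \<mu> i}. u - a r) = 1" if "\<not> \<nu> i < \<mu> i"
      using that by (simp add: pos_def)
    moreover have "\<nu> i < \<mu> i" if "\<mu> (Suc i) = \<nu> i + 1" using that mu_Suc_le[of i] by simp
    ultimately show ?thesis
      by (cases "\<nu> i < \<mu> i"; cases "\<mu> (Suc i) = \<nu> i + 1")
         (simp_all add: reduced_ker_def branch_ker_def mult.commute)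
  qed
  have fin: "finite (diagram \<mu> - diagram \<nu>)" using finite_diagram[OF \<mu>] by simp
  show ?thesis
    unfolding f_skew_eq[OF fin] card_components_skew tails prod_skew_vertical prod_skew_horizontal
    by (simp only: row prod.distrib[symmetric] prod.case)
qed

end

text \<open>The three cases are: \<open>\<nu>\<close> not inside \<open>\<mu>\<close>, a 2 x 2 block
  in the difference, and a difference made of skew hooks.\<close>

lemma det_branch_ker_pos:
  assumes \<mu>: "\<mu> \<in> shapes n m" and \<nu>: "\<nu> \<in> shapes n m"
  shows "det (mat n n (\<lambda>(i, j). branch_ker a u v (pos \<mu> i) (pos \<nu> j)))
    = (if \<forall>i. \<nu> i \<le> \<mu> i \<and> \<mu> (Suc i) \<le> \<nu> i + 1 then f_skew a (diagram \<mu> - diagram \<nu>) u v else 0)"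
proof -
  have p: "\<And>i j. i < j \<Longrightarrow> pos \<mu> j < pos \<mu> i" and q: "\<And>i j. i < j \<Longrightarrow> pos \<nu> j < pos \<nu> i"
    using \<mu> \<nu> pos_decreasing by (auto simp: shapes_def)
  have pq: "pos \<mu> n < pos \<nu> j" if "j < n" for j
    using that \<mu> by (simp add: pos_def shapes_def)
  \<comment> \<open>A violated condition involves a nonzero part, so its row lies within the
    matrix.\<close>
  have out: "i < n" if "\<mu> (Suc i) \<noteq> 0 \<or> \<nu> i \<noteq> 0" for i
    using that \<mu> \<nu> unfolding shapes_def by (auto intro: ccontr simp: not_less)
  consider i where "\<mu> i < \<nu> i" | i where "\<nu> i + 1 < \<mu> (Suc i)"
    | "\<forall>i. \<nu> i \<le> \<mu> i \<and> \<mu> (Suc i) \<le> \<nu> i + 1"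
    by (meson not_le)
  then show ?thesis
  proof cases
    case 1
    have "det (mat n n (\<lambda>(i, j). branch_ker a u v (pos \<mu> i) (pos \<nu> j))) = 0"
      by (rule det_branch_ker_not_contained[of "pos \<mu>" "pos \<nu>" n, OF p q pq, of i]) (use 1 out[of i] in \<open>auto simp: pos_def\<close>)
    moreover have "\<not> (\<forall>i. \<nu> i \<le> \<mu> i \<and> \<mu> (Suc i) \<le> \<nu> i + 1)" using 1 not_le by blast
    ultimately show ?thesis by (simp only: if_False)
  next
    case 2
    have "det (mat n n (\<lambda>(i, j). branch_ker a u v (pos \<mu> i) (pos \<nu> j))) = 0"
      by (rule det_branch_ker_block[of "pos \<mu>" "pos \<nu>" n, OF p q pq, of i]) (use 2 out[of i] in \<open>auto simp: pos_def\<close>)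
    moreover have "\<not> (\<forall>i. \<nu> i \<le> \<mu> i \<and> \<mu> (Suc i) \<le> \<nu> i + 1)" using 2 not_le by blast
    ultimately show ?thesis by (simp only: if_False)
  next
    case 3
    have "det (mat n n (\<lambda>(i, j). branch_ker a u v (pos \<mu> i) (pos \<nu> j)))
        = (\<Prod>i = 0..<n. reduced_ker a u v (pos \<mu> i) (pos \<mu> (Suc i)) (pos \<nu> i))"
    proof (rule det_branch_ker_hook[of "pos \<mu>" "pos \<nu>" n, OF p q pq])
      fix i show "pos \<nu> i \<le> pos \<mu> i" "pos \<mu> (Suc i) \<le> pos \<nu> i" using 3[rule_format, of i] by (auto simp: pos_def)
    qed
    then show ?thesis using f_skew_diagram[OF \<mu> \<nu>] 3 by simp
  qed
qed

section \<open>Tableaux\<close>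

text \<open>Stated for an arbitrary set of boxes, so that the recursion can pass to diagrams of
  shapes given by functions instead of lists.\<close>

definition strict_tableau :: "(nat \<times> nat) set \<Rightarrow> (nat \<times> nat \<Rightarrow> nat) \<Rightarrow> bool" where
  "strict_tableau S T \<longleftrightarrow>
     (\<forall>b. b \<notin> S \<longrightarrow> T b = 0) \<and>
     (\<forall>b\<in>S. 1 \<le> T b) \<and>
     (\<forall>i j. (i, j) \<in> S \<and> (i, j + 1) \<in> S \<longrightarrow> T (i, j) \<le> T (i, j + 1)) \<and>
     (\<forall>i j. (i, j) \<in> S \<and> (i + 1, j) \<in> S \<longrightarrow> T (i, j) \<le> T (i + 1, j)) \<and>
     (\<forall>i j. (i, j) \<in> S \<and> (i + 1, j + 1) \<in> S \<longrightarrow> T (i, j) < T (i + 1, j + 1))"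

text \<open>Bounding the labels by \<open>n\<close> corresponds to having \<open>n\<close> pairs of
  variables, and leaves finitely many tableaux on a finite set.\<close>

definition tableaux :: "nat \<Rightarrow> (nat \<times> nat) set \<Rightarrow> (nat \<times> nat \<Rightarrow> nat) set" where
  "tableaux n S = {T. strict_tableau S T \<and> (\<forall>b. T b \<le> n)}"

definition tableau_weight :: "(int \<Rightarrow> complex) \<Rightarrow> (nat \<Rightarrow> complex) \<Rightarrow> (nat \<Rightarrow> complex) \<Rightarrow> nat
    \<Rightarrow> (nat \<times> nat) set \<Rightarrow> (nat \<times> nat \<Rightarrow> nat) \<Rightarrow> complex" where
  "tableau_weight a x y n S T = (\<Prod>k\<in>{1..n}. f_skew a {b \<in> S. T b = k} (x k) (y k))"

lemma tableaux_le: "T \<in> tableaux n S \<Longrightarrow> T b \<le> n"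
  unfolding tableaux_def by blast

lemma tableaux_strict: "T \<in> tableaux n S \<Longrightarrow> strict_tableau S T"
  unfolding tableaux_def by blast

lemma strict_tableau_outside: "strict_tableau S T \<Longrightarrow> b \<notin> S \<Longrightarrow> T b = 0"
  unfolding strict_tableau_def by blast

lemma finite_tableaux:
  assumes "finite S" shows "finite (tableaux n S)"
proof (rule finite_subset)
  show "tableaux n S \<subseteq> {T. \<forall>b. (b \<in> S \<longrightarrow> T b \<in> {..n}) \<and> (b \<notin> S \<longrightarrow> T b = 0)}"
    by (auto simp: tableaux_def strict_tableau_def)
  show "finite {T. \<forall>b. (b \<in> S \<longrightarrow> T b \<in> {..n}) \<and> (b \<notin> S \<longrightarrow> T b = (0 :: nat))}"
    using assms by (intro finite_set_of_finite_funs) auto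
qed

lemma initial_segment_eq:
  fixes A :: "nat set"
  assumes A: "A \<subseteq> {1..m}" and down: "\<And>j. 1 \<le> j \<Longrightarrow> Suc j \<in> A \<Longrightarrow> j \<in> A"
  shows "A = {1..card A}"
proof (cases "A = {}")
  case False
  have fin: "finite A" using A finite_subset by blast
  define M where "M = Max A"
  have M: "M \<in> A" and le: "\<And>j. j \<in> A \<Longrightarrow> j \<le> M"
    using fin False by (auto simp: M_def)
  have "j \<in> A" if "1 \<le> j" "j \<le> M" for j
    using that(2,1)
  proof (induction rule: inc_induct)
    case base
    show ?case by (rule M)
  next
    case (step k)
    then show ?case using down[of k] by simp
  qed
  then have "A = {1..M}" using le A by force
  then show ?thesis by (metis card_atLeastAtMost diff_Suc_1)
qed simp

lemma diagram_inject:
  assumes "diagram \<nu> = diagram \<kappa>" shows "\<nu> = \<kappa>"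
proof
  fix i
  have "{1..\<nu> i} = {j. (Suc i, j) \<in> diagram \<nu>}" by auto
  also have "\<dots> = {1..\<kappa> i}" unfolding assms by auto
  finally show "\<nu> i = \<kappa> i" by (metis card_atLeastAtMost diff_Suc_1)
qed

lemma diagram_subset_iff: "diagram \<nu> \<subseteq> diagram \<mu> \<longleftrightarrow> (\<forall>i. \<nu> i \<le> \<mu> i)"
proof
  assume sub: "diagram \<nu> \<subseteq> diagram \<mu>"
  show "\<forall>i. \<nu> i \<le> \<mu> i"
  proof
    fix i show "\<nu> i \<le> \<mu> i"
      using subsetD[OF sub, of "(Suc i, \<nu> i)"] by (cases "\<nu> i = 0") auto
  qed
qed (auto simp: diagram_def intro: order_trans)

definition hook_subshapes :: "nat \<Rightarrow> nat \<Rightarrow> (nat \<Rightarrow> nat) \<Rightarrow> (nat \<Rightarrow> nat) set" where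
  "hook_subshapes n m \<mu> = {\<nu> \<in> shapes n m. \<forall>i. \<nu> i \<le> \<mu> i \<and> \<mu> (Suc i) \<le> \<nu> i + 1}"

definition extend_tableau :: "(nat \<Rightarrow> nat) \<Rightarrow> nat \<Rightarrow> (nat \<Rightarrow> nat) \<Rightarrow> (nat \<times> nat \<Rightarrow> nat) \<Rightarrow> nat \<times> nat \<Rightarrow> nat" where
  "extend_tableau \<mu> k \<nu> T = (\<lambda>b. if b \<in> diagram \<nu> then T b else if b \<in> diagram \<mu> then k else 0)"

section \<open>Removing the boxes with the largest label\<close>

context
  fixes \<mu> :: "nat \<Rightarrow> nat" and n m r :: nat
  assumes \<mu>: "\<mu> \<in> shapes n m"
begin

text \<open>The smaller labels recover \<open>\<nu>\<close> from the extended tableau, which gives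
  injectivity of the extension.\<close>

lemma extend_tableau_lower_boxes:
  assumes "\<nu> \<in> hook_subshapes n m \<mu>" "T \<in> tableaux r (diagram \<nu>)"
  shows "{b \<in> diagram \<mu>. extend_tableau \<mu> (Suc r) \<nu> T b \<le> r} = diagram \<nu>"
proof -
  have "diagram \<nu> \<subseteq> diagram \<mu>"
    unfolding diagram_subset_iff using assms(1) by (simp add: hook_subshapes_def)
  then show ?thesis using assms(2) by (auto simp: extend_tableau_def tableaux_def)
qed

lemma extend_tableau_in_tableaux:
  assumes \<nu>: "\<nu> \<in> hook_subshapes n m \<mu>" and T: "T \<in> tableaux r (diagram \<nu>)"
  shows "extend_tableau \<mu> (Suc r) \<nu> T \<in> tableaux (Suc r) (diagram \<mu>)"
proof -
  let ?F = "extend_tableau \<mu> (Suc r) \<nu> T"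
  have sub: "diagram \<nu> \<subseteq> diagram \<mu>"
    unfolding diagram_subset_iff using \<nu> by (simp add: hook_subshapes_def)
  have hook: "\<mu> (Suc i) \<le> \<nu> i + 1" for i using \<nu> by (simp add: hook_subshapes_def)
  have dec: "\<nu> (Suc i) \<le> \<nu> i" for i using \<nu> by (auto simp: hook_subshapes_def shapes_def antimono_def)
  note Tle = tableaux_le[OF T]
  note st = tableaux_strict[OF T]
  have F_in: "?F b = T b" if "b \<in> diagram \<nu>" for b using that by (simp add: extend_tableau_def)
  have F_out: "?F b = Suc r" if "b \<in> diagram \<mu>" "b \<notin> diagram \<nu>" for b
    using that by (simp add: extend_tableau_def)
  have F_le: "?F b \<le> Suc r" for b using Tle[of b] by (simp add: extend_tableau_def)
  have "?F (i, j) \<le> ?F (i, j + 1)" if "(i, j) \<in> diagram \<mu>" "(i, j + 1) \<in> diagram \<mu>" for i j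
  proof (cases "(i, j + 1) \<in> diagram \<nu>")
    case True
    then have "(i, j) \<in> diagram \<nu>" using that by (auto simp: diagram_def)
    then show ?thesis using True st by (simp add: F_in strict_tableau_def)
  next
    case False
    then show ?thesis using F_le that by (simp add: F_out)
  qed
  moreover have "?F (i, j) \<le> ?F (i + 1, j)" if "(i, j) \<in> diagram \<mu>" "(i + 1, j) \<in> diagram \<mu>" for i j
  proof (cases "(i + 1, j) \<in> diagram \<nu>")
    case True
    then have "(i, j) \<in> diagram \<nu>" using that dec[of "i - 1"] by (cases i) auto
    then show ?thesis using True st by (simp add: F_in strict_tableau_def)
  next
    case False
    then show ?thesis using F_le that by (simp add: F_out)
  qed
  moreover have "?F (i, j) < ?F (i + 1, j + 1)"
    if "(i, j) \<in> diagram \<mu>" "(i + 1, j + 1) \<in> diagram \<mu>" for i j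
  proof -
    \<comment> \<open>\<open>hook\<close> places the upper left diagonal neighbour of a box of
      \<open>\<mu>\<close> inside \<open>\<nu>\<close>, where labels are at most
      \<open>r\<close>.\<close>
    have ij: "(i, j) \<in> diagram \<nu>" using that hook[of "i - 1"] by (cases i) auto
    show ?thesis
    proof (cases "(i + 1, j + 1) \<in> diagram \<nu>")
      case True
      then show ?thesis using ij st by (simp add: F_in strict_tableau_def)
    next
      case False
      then show ?thesis using ij that Tle[of "(i, j)"] by (simp add: F_in F_out)
    qed
  qed
  moreover have "1 \<le> ?F b" if "b \<in> diagram \<mu>" for b
    using st that by (auto simp: extend_tableau_def strict_tableau_def)
  moreover have "?F b = 0" if "b \<notin> diagram \<mu>" for b
    using that sub by (auto simp: extend_tableau_def)
  ultimately show ?thesis using F_le unfolding tableaux_def strict_tableau_def by blast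
qed

text \<open>Monotone labels make the boxes with label at most \<open>r\<close> a diagram
  \<open>\<nu>\<close>, and strictness along diagonals keeps 2 x 2 blocks out of the removed
  part.\<close>

lemma tableau_restriction_exists:
  assumes F: "F \<in> tableaux (Suc r) (diagram \<mu>)"
  obtains \<nu> T where "\<nu> \<in> hook_subshapes n m \<mu>" "T \<in> tableaux r (diagram \<nu>)"
    "F = extend_tableau \<mu> (Suc r) \<nu> T"
proof -
  note st = tableaux_strict[OF F] and F_le = tableaux_le[OF F]
  note out = strict_tableau_outside[OF st]
  have pos: "1 \<le> F b" if "b \<in> diagram \<mu>" for b using st that by (simp add: strict_tableau_def)
  have row: "F (i, j) \<le> F (i, j + 1)" if "(i, j) \<in> diagram \<mu>" "(i, j + 1) \<in> diagram \<mu>" for i j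
    using st that by (simp add: strict_tableau_def)
  have col: "F (i, j) \<le> F (i + 1, j)" if "(i, j) \<in> diagram \<mu>" "(i + 1, j) \<in> diagram \<mu>" for i j
    using st that by (simp add: strict_tableau_def)
  have dia: "F (i, j) < F (i + 1, j + 1)" if "(i, j) \<in> diagram \<mu>" "(i + 1, j + 1) \<in> diagram \<mu>" for i j
    using st that by (simp add: strict_tableau_def)
  have dec: "\<mu> (Suc i) \<le> \<mu> i" for i using \<mu> by (auto simp: shapes_def antimono_def)
  define A where "A i = {j \<in> {1..\<mu> i}. F (Suc i, j) \<le> r}" for i
  define \<nu> where "\<nu> i = card (A i)" for i
  have A: "A i = {1..\<nu> i}" for i
    unfolding \<nu>_def
  proof (rule initial_segment_eq[of _ "\<mu> i"])
    fix j assume "1 \<le> j" "Suc j \<in> A i"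
    then show "j \<in> A i" using row[of "Suc i" j] by (auto simp: A_def)
  qed (auto simp: A_def)
  have mem: "(Suc i, j) \<in> diagram \<nu> \<longleftrightarrow> (Suc i, j) \<in> diagram \<mu> \<and> F (Suc i, j) \<le> r" for i j
    using A[of i] unfolding A_def set_eq_iff by auto
  have D: "diagram \<nu> = {b \<in> diagram \<mu>. F b \<le> r}"
  proof (rule Set.set_eqI)
    fix b :: "nat \<times> nat"
    show "b \<in> diagram \<nu> \<longleftrightarrow> b \<in> {b \<in> diagram \<mu>. F b \<le> r}"
      using mem by (cases b; cases "fst b") auto
  qed
  have sub: "\<nu> i \<le> \<mu> i" for i
    using D diagram_subset_iff[of \<nu> \<mu>] by auto
  have "\<nu> (Suc i) \<le> \<nu> i" for i
  proof -
    have "A (Suc i) \<subseteq> A i"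
      using dec[of i] col[of "Suc i"] by (fastforce simp: A_def)
    then show ?thesis unfolding A by auto
  qed
  then have "decseq \<nu>" by (rule decseq_SucI)
  then have sh: "\<nu> \<in> shapes n m"
    using \<mu> sub order_trans[OF sub[of 0]] by (auto simp: shapes_def) (metis le_zero_eq)
  have "\<mu> (Suc i) \<le> \<nu> i + 1" for i
  proof (cases "\<mu> (Suc i) \<le> 1")
    case False
    then obtain j where j: "\<mu> (Suc i) = Suc j" "1 \<le> j" by (cases "\<mu> (Suc i)") auto
    \<comment> \<open>The last box of row \<open>Suc i\<close> has label at most
      \<open>Suc r\<close>, so its upper left neighbour has label at most \<open>r\<close> and
      belongs to \<open>\<nu>\<close>.\<close>
    have "F (Suc i, j) < F (Suc (Suc i), Suc j)"
      using dia[of "Suc i" j] j dec[of i] by auto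
    then have "j \<in> A i" using F_le[of "(Suc (Suc i), Suc j)"] j dec[of i] by (auto simp: A_def)
    then show ?thesis using A j by auto
  qed simp
  then have \<nu>: "\<nu> \<in> hook_subshapes n m \<mu>" using sub sh by (simp add: hook_subshapes_def)
  define T where "T b = (if b \<in> diagram \<nu> then F b else 0)" for b
  have "strict_tableau (diagram \<nu>) T"
    unfolding strict_tableau_def using row col dia pos by (simp add: T_def D)
  moreover have "T b \<le> r" for b by (simp add: T_def D)
  ultimately have T: "T \<in> tableaux r (diagram \<nu>)" by (simp add: tableaux_def)
  have "F = extend_tableau \<mu> (Suc r) \<nu> T"
  proof
    fix b show "F b = extend_tableau \<mu> (Suc r) \<nu> T b"
      using F_le[of b] out[of b] by (auto simp: extend_tableau_def T_def D)
  qed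
  then show thesis using that \<nu> T by blast
qed

lemma bij_betw_extend_tableau:
  "bij_betw (\<lambda>(\<nu>, T). extend_tableau \<mu> (Suc r) \<nu> T)
     (SIGMA \<nu>:hook_subshapes n m \<mu>. tableaux r (diagram \<nu>)) (tableaux (Suc r) (diagram \<mu>))"
proof (rule bij_betw_imageI)
  show "inj_on (\<lambda>(\<nu>, T). extend_tableau \<mu> (Suc r) \<nu> T) (SIGMA \<nu>:hook_subshapes n m \<mu>. tableaux r (diagram \<nu>))"
  proof (rule inj_onI, clarify)
    fix \<nu> T \<kappa> U
    assume \<nu>: "\<nu> \<in> hook_subshapes n m \<mu>" and T: "T \<in> tableaux r (diagram \<nu>)"
      and \<kappa>: "\<kappa> \<in> hook_subshapes n m \<mu>" and U: "U \<in> tableaux r (diagram \<kappa>)"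
      and eq: "extend_tableau \<mu> (Suc r) \<nu> T = extend_tableau \<mu> (Suc r) \<kappa> U"
    have \<nu>\<kappa>: "\<nu> = \<kappa>"
      using extend_tableau_lower_boxes[OF \<nu> T] extend_tableau_lower_boxes[OF \<kappa> U] eq
      by (intro diagram_inject) simp
    have "T b = U b" for b
    proof (cases "b \<in> diagram \<nu>")
      case True
      then show ?thesis using fun_cong[OF eq, of b] \<nu>\<kappa> by (simp add: extend_tableau_def)
    next
      case False
      then show ?thesis
        using strict_tableau_outside[OF tableaux_strict[OF T]] strict_tableau_outside[OF tableaux_strict[OF U]] \<nu>\<kappa>
        by simp
    qed
    then show "\<nu> = \<kappa> \<and> T = U" using \<nu>\<kappa> by auto
  qed
  show "(\<lambda>(\<nu>, T). extend_tableau \<mu> (Suc r) \<nu> T) ` (SIGMA \<nu>:hook_subshapes n m \<mu>. tableaux r (diagram \<nu>))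
      = tableaux (Suc r) (diagram \<mu>)"
  proof (intro equalityI subsetI)
    fix F assume "F \<in> tableaux (Suc r) (diagram \<mu>)"
    then obtain \<nu> T where "\<nu> \<in> hook_subshapes n m \<mu>" "T \<in> tableaux r (diagram \<nu>)"
      "F = extend_tableau \<mu> (Suc r) \<nu> T" by (rule tableau_restriction_exists)
    then show "F \<in> (\<lambda>(\<nu>, T). extend_tableau \<mu> (Suc r) \<nu> T) ` (SIGMA \<nu>:hook_subshapes n m \<mu>. tableaux r (diagram \<nu>))"
      by force
  qed (auto simp: extend_tableau_in_tableaux)
qed

lemma tableau_weight_extend:
  assumes \<nu>: "\<nu> \<in> hook_subshapes n m \<mu>" and T: "T \<in> tableaux r (diagram \<nu>)"
  shows "tableau_weight a x y (Suc r) (diagram \<mu>) (extend_tableau \<mu> (Suc r) \<nu> T)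
    = f_skew a (diagram \<mu> - diagram \<nu>) (x (Suc r)) (y (Suc r)) * tableau_weight a x y r (diagram \<nu>) T"
proof -
  have sub: "diagram \<nu> \<subseteq> diagram \<mu>"
    unfolding diagram_subset_iff using \<nu> by (simp add: hook_subshapes_def)
  note Tle = tableaux_le[OF T]
  have "{b \<in> diagram \<mu>. extend_tableau \<mu> (Suc r) \<nu> T b = Suc r} = diagram \<mu> - diagram \<nu>"
  proof -
    have "T b \<noteq> Suc r" for b using Tle[of b] by simp
    then show ?thesis by (auto simp: extend_tableau_def simp del: split_paired_All)
  qed
  moreover have "{b \<in> diagram \<mu>. extend_tableau \<mu> (Suc r) \<nu> T b = k} = {b \<in> diagram \<nu>. T b = k}"
    if "k \<in> {1..r}" for k
    using that sub by (auto simp: extend_tableau_def)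
  ultimately show ?thesis by (simp add: tableau_weight_def mult.commute)
qed

end

lemma finite_shapes: "finite (shapes n m)"
proof -
  have "finite ({0..<n} \<rightarrow>\<^sub>E {0..<n + m})" by (intro finite_PiE) auto
  then have "finite (decreasing_maps n (n + m))"
    unfolding decreasing_maps_def by simp
  then show ?thesis
    using bij_betw_finite[OF bij_betw_shapes_decreasing_maps] by blast
qed

lemma tableau_sum_branch:
  assumes \<mu>: "\<mu> \<in> shapes n m"
  shows "(\<Sum>T\<in>tableaux (Suc r) (diagram \<mu>). tableau_weight a x y (Suc r) (diagram \<mu>) T)
    = (\<Sum>\<nu>\<in>hook_subshapes n m \<mu>. f_skew a (diagram \<mu> - diagram \<nu>) (x (Suc r)) (y (Suc r))
        * (\<Sum>T\<in>tableaux r (diagram \<nu>). tableau_weight a x y r (diagram \<nu>) T))"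
proof -
  have fin: "finite (hook_subshapes n m \<mu>)" "\<forall>\<nu>\<in>hook_subshapes n m \<mu>. finite (tableaux r (diagram \<nu>))"
    using finite_shapes by (auto simp: hook_subshapes_def intro: finite_tableaux finite_diagram)
  have "(\<Sum>T\<in>tableaux (Suc r) (diagram \<mu>). tableau_weight a x y (Suc r) (diagram \<mu>) T)
     = (\<Sum>(\<nu>, T)\<in>(SIGMA \<nu>:hook_subshapes n m \<mu>. tableaux r (diagram \<nu>)).
          tableau_weight a x y (Suc r) (diagram \<mu>) (extend_tableau \<mu> (Suc r) \<nu> T))"
    using sum.reindex_bij_betw[OF bij_betw_extend_tableau[OF \<mu>, of r],
        of "tableau_weight a x y (Suc r) (diagram \<mu>)"]
    by (simp add: case_prod_unfold)
  also have "\<dots> = (\<Sum>\<nu>\<in>hook_subshapes n m \<mu>. \<Sum>T\<in>tableaux r (diagram \<nu>).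
          tableau_weight a x y (Suc r) (diagram \<mu>) (extend_tableau \<mu> (Suc r) \<nu> T))"
    using fin by (rule sum.Sigma[symmetric])
  also have "\<dots> = (\<Sum>\<nu>\<in>hook_subshapes n m \<mu>. f_skew a (diagram \<mu> - diagram \<nu>) (x (Suc r)) (y (Suc r))
        * (\<Sum>T\<in>tableaux r (diagram \<nu>). tableau_weight a x y r (diagram \<nu>) T))"
    by (intro sum.cong refl) (simp add: tableau_weight_extend[OF \<mu>] sum_distrib_left)
  finally show ?thesis .
qed

section \<open>Truncation to finitely many variables and conclusion\<close>

definition trunc :: "nat \<Rightarrow> (nat \<Rightarrow> complex) \<Rightarrow> nat \<Rightarrow> complex" where
  "trunc n x = (\<lambda>i. if 1 \<le> i \<and> i \<le> n then x i else 0)"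

lemma pxy_trunc:
  assumes "k \<ge> 1"
  shows "pxy (trunc n x) (trunc n y) k = (\<Sum>i\<in>{1..n}. x i ^ k) + (-1) ^ (k - 1) * (\<Sum>i\<in>{1..n}. y i ^ k)"
proof -
  have "(\<Sum>i\<in>{i. 1 \<le> i \<and> trunc n z i \<noteq> 0}. trunc n z i ^ k) = (\<Sum>i\<in>{1..n}. z i ^ k)" for z
    using assms by (intro sum.mono_neutral_cong_left) (auto simp: trunc_def split: if_splits)
  then show ?thesis by (simp add: pxy_def)
qed

lemma hxy_trunc_0: "hxy (trunc 0 x) (trunc 0 y) (Suc n) = 0"
proof -
  have "of_nat (Suc n) * hxy (trunc 0 x) (trunc 0 y) (Suc n) = 0"
    unfolding hxy_Suc by (simp add: pxy_trunc)
  then show ?thesis by (simp del: of_nat_Suc)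
qed

lemma hka_trunc_0: "hka k a (trunc 0 x) (trunc 0 y) = (if k = 0 then 1 else 0)"
proof -
  have "hxy (trunc 0 x) (trunc 0 y) i = 0" if "i \<in> {1..nat k}" for i
    using that hxy_trunc_0 by (cases i) auto
  then show ?thesis by (simp add: hka_def)
qed

text \<open>Without variables only the function of index 0 survives. The empty shape gives the
  identity matrix and the one empty tableau; for any other shape the first row of the matrix is zero
  and no label is available.\<close>

lemma hdet_trunc_0:
  assumes \<mu>: "\<mu> \<in> shapes n m"
  shows "hdet n a (trunc 0 x) (trunc 0 y) \<mu> = (\<Sum>T\<in>tableaux 0 (diagram \<mu>). tableau_weight a x y 0 (diagram \<mu>) T)"
proof (cases "\<mu> 0 = 0")
  case True
  then have zero: "\<mu> i = 0" for i using \<mu> by (auto simp: shapes_def dest: antimonoD[of _ 0 i])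
  then have "diagram \<mu> = {}" by (auto simp: diagram_def)
  then have "tableaux 0 (diagram \<mu>) = {\<lambda>_. 0}"
    by (auto simp: tableaux_def strict_tableau_def)
  moreover have "mat n n (\<lambda>(i, j). hka (pos \<mu> i + 1 + int j) (shift_seq (- int j) a) (trunc 0 x) (trunc 0 y)) = 1\<^sub>m n"
    by (rule eq_matI) (auto simp: hka_trunc_0 pos_def zero)
  ultimately show ?thesis by (simp add: hdet_def tableau_weight_def)
next
  case False
  then have n: "0 < n" using \<mu> by (auto simp: shapes_def)
  have "hdet n a (trunc 0 x) (trunc 0 y) \<mu> = 0"
    unfolding hdet_def
    by (rule det_zero_block[of _ n "{0}" "{0..<n}"]) (use n False in \<open>auto simp: hka_trunc_0 pos_def\<close>)
  moreover have "T \<notin> tableaux 0 (diagram \<mu>)" for T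
  proof
    assume T: "T \<in> tableaux 0 (diagram \<mu>)"
    have "(Suc 0, 1) \<in> diagram \<mu>" using False by simp
    then have "1 \<le> T (Suc 0, 1)" using tableaux_strict[OF T] unfolding strict_tableau_def by blast
    then show False using tableaux_le[OF T, of "(Suc 0, 1)"] by simp
  qed
  ultimately show ?thesis by (metis all_not_in_conv sum.empty)
qed

text \<open>Induction on the number of variable pairs: both sides branch over the same shapes
  \<open>\<nu>\<close> with the same factors.\<close>

lemma hdet_trunc:
  assumes "\<mu> \<in> shapes n m"
  shows "hdet n a (trunc r x) (trunc r y) \<mu> = (\<Sum>T\<in>tableaux r (diagram \<mu>). tableau_weight a x y r (diagram \<mu>) T)"
  using assms
proof (induction r arbitrary: \<mu>)
  case 0
  then show ?case by (rule hdet_trunc_0)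
next
  case (Suc r)
  let ?u = "x (Suc r)" and ?v = "y (Suc r)"
  have h: "hxy (trunc (Suc r) x) (trunc (Suc r) y) (Suc k)
      = ?u * hxy (trunc (Suc r) x) (trunc (Suc r) y) k + hxy (trunc r x) (trunc r y) (Suc k)
        + ?v * hxy (trunc r x) (trunc r y) k" for k
    by (rule hxy_adjoin) (simp add: pxy_trunc algebra_simps)
  have "hdet n a (trunc (Suc r) x) (trunc (Suc r) y) \<mu> = (\<Sum>\<nu>\<in>shapes n m.
      det (mat n n (\<lambda>(i, j). branch_ker a ?u ?v (pos \<mu> i) (pos \<nu> j))) * hdet n a (trunc r x) (trunc r y) \<nu>)"
    by (rule hdet_branch[OF h Suc.prems])
  also have "\<dots> = (\<Sum>\<nu>\<in>shapes n m. if \<forall>i. \<nu> i \<le> \<mu> i \<and> \<mu> (Suc i) \<le> \<nu> i + 1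
      then f_skew a (diagram \<mu> - diagram \<nu>) ?u ?v
        * (\<Sum>T\<in>tableaux r (diagram \<nu>). tableau_weight a x y r (diagram \<nu>) T) else 0)"
    by (intro sum.cong refl) (simp add: det_branch_ker_pos[OF Suc.prems] Suc.IH)
  also have "\<dots> = (\<Sum>\<nu>\<in>hook_subshapes n m \<mu>. f_skew a (diagram \<mu> - diagram \<nu>) ?u ?v
        * (\<Sum>T\<in>tableaux r (diagram \<nu>). tableau_weight a x y r (diagram \<nu>) T))"
    unfolding hook_subshapes_def by (rule sum.inter_filter[OF finite_shapes, symmetric])
  also have "\<dots> = (\<Sum>T\<in>tableaux (Suc r) (diagram \<mu>). tableau_weight a x y (Suc r) (diagram \<mu>) T)"
    by (rule tableau_sum_branch[OF Suc.prems, symmetric])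
  finally show ?case .
qed

lemma schur_a_eq_hdet:
  "schur_a \<mu> a x y = hdet (length \<mu>) a x y (\<lambda>i. part \<mu> (Suc i))"
  unfolding schur_a_def hdet_def
  by (rule arg_cong[where f = det], rule cong_mat) (simp_all add: pos_def algebra_simps)

lemma hdet_cong:
  assumes "\<And>k. hxy x y k = hxy x' y' k"
  shows "hdet n a x y \<nu> = hdet n a x' y' \<nu>"
proof -
  have "hka k b x y = hka k b x' y'" for k b by (simp add: hka_def assms)
  then show ?thesis by (simp add: hdet_def)
qed

lemma young_diagram_shapes:
  assumes "young_diagram \<mu>"
  shows "(\<lambda>i. part \<mu> (Suc i)) \<in> shapes (length \<mu>) (part \<mu> 1)"
proof -
  have "decseq (\<lambda>i. part \<mu> (Suc i))"
    using assms unfolding young_diagram_def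
    by (intro decseq_SucI) (auto simp: part_def sorted_wrt_iff_nth_less)
  then show ?thesis by (auto simp: shapes_def part_def)
qed

lemma diagram_eq_boxes: "diagram (\<lambda>i. part \<mu> (Suc i)) = boxes \<mu>"
  by (auto simp: diagram_def boxes_def part_def split: if_splits)

lemma hxy_trunc_eq:
  assumes "\<And>i. x i \<noteq> 0 \<Longrightarrow> i \<le> n" "\<And>i. y i \<noteq> 0 \<Longrightarrow> i \<le> n"
  shows "hxy x y k = hxy (trunc n x) (trunc n y) k"
proof (rule hxy_cong)
  fix k :: nat
  have "(\<Sum>i\<in>{i. 1 \<le> i \<and> z i \<noteq> 0}. z i ^ k) = (\<Sum>i\<in>{i. 1 \<le> i \<and> trunc n z i \<noteq> 0}. trunc n z i ^ k)"
    if "\<And>i. z i \<noteq> 0 \<Longrightarrow> i \<le> n" for z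
    using that by (intro sum.cong) (auto simp: trunc_def split: if_splits)
  then show "pxy x y k = pxy (trunc n x) (trunc n y) k" using assms by (simp add: pxy_def)
qed

theorem theorem14:
  fixes a :: "int \<Rightarrow> complex" and \<mu> :: "nat list" and x y :: "nat \<Rightarrow> complex"
  assumes "young_diagram \<mu>"
    and "finite {i. x i \<noteq> 0}" and "finite {j. y j \<noteq> 0}"
  shows "((\<lambda>T. \<Prod>k\<in>T ` boxes \<mu>. f_skew a {b \<in> boxes \<mu>. T b = k} (x k) (y k))
           has_sum schur_a \<mu> a x y) {T. diag_strict_tableau \<mu> T}"
proof -
  let ?S = "boxes \<mu>"
  let ?w = "\<lambda>T. \<Prod>k\<in>T ` ?S. f_skew a {b \<in> ?S. T b = k} (x k) (y k)"
  have shape: "(\<lambda>i. part \<mu> (Suc i)) \<in> shapes (length \<mu>) (part \<mu> 1)"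
    using assms(1) by (rule young_diagram_shapes)
  have fin: "finite ?S" using finite_diagram[OF shape] by (simp add: diagram_eq_boxes)
  have tab: "diag_strict_tableau \<mu> T \<longleftrightarrow> strict_tableau ?S T" for T
    by (simp add: diag_strict_tableau_def strict_tableau_def)
  obtain n where n: "\<And>i. x i \<noteq> 0 \<Longrightarrow> i \<le> n" "\<And>i. y i \<noteq> 0 \<Longrightarrow> i \<le> n"
  proof -
    have "finite ({i. x i \<noteq> 0} \<union> {j. y j \<noteq> 0})" using assms by simp
    then obtain n where "\<forall>i\<in>{i. x i \<noteq> 0} \<union> {j. y j \<noteq> 0}. i \<le> n"
      using finite_nat_set_iff_bounded_le by blast
    then show thesis using that by blast
  qed
  have "schur_a \<mu> a x y = hdet (length \<mu>) a (trunc n x) (trunc n y) (\<lambda>i. part \<mu> (Suc i))"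
    unfolding schur_a_eq_hdet using hxy_trunc_eq[OF n] by (rule hdet_cong)
  also have "\<dots> = (\<Sum>T\<in>tableaux n ?S. tableau_weight a x y n ?S T)"
    using hdet_trunc[OF shape] unfolding diagram_eq_boxes .
  \<comment> \<open>A label that does not occur has an empty level set, whose factor is 1.\<close>
  also have "\<dots> = (\<Sum>T\<in>tableaux n ?S. ?w T)"
  proof (intro sum.cong refl)
    fix T assume T: "T \<in> tableaux n ?S"
    then have "T ` ?S \<subseteq> {1..n}" by (auto simp: tableaux_def strict_tableau_def)
    moreover have "f_skew a {b \<in> ?S. T b = k} (x k) (y k) = 1" if "k \<in> {1..n} - T ` ?S" for k
    proof -
      have "{b \<in> ?S. T b = k} = {}" using that by auto
      then show ?thesis by (simp only: f_skew_empty)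
    qed
    ultimately show "tableau_weight a x y n ?S T = ?w T"
      unfolding tableau_weight_def by (intro prod.mono_neutral_right) auto
  qed
  finally have sum: "schur_a \<mu> a x y = (\<Sum>T\<in>tableaux n ?S. ?w T)" .
  show ?thesis
  \<comment> \<open>The sum is effectively finite: by the choice of \<open>n\<close>, a tableau with
    a label above \<open>n\<close> has a factor in which both variables are zero.\<close>
  proof (rule has_sum_finite_neutralI[of "tableaux n ?S"])
    show "finite (tableaux n ?S)" using fin by (rule finite_tableaux)
    show "tableaux n ?S \<subseteq> {T. diag_strict_tableau \<mu> T}" by (auto simp: tableaux_def tab)
    show "schur_a \<mu> a x y = (\<Sum>T\<in>tableaux n ?S. ?w T)" by (rule sum)
    fix T assume "T \<in> {T. diag_strict_tableau \<mu> T} - tableaux n ?S"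
    then have T: "strict_tableau ?S T" and "\<exists>b. \<not> T b \<le> n" by (auto simp: tableaux_def tab)
    then obtain b where b: "n < T b" by (auto simp: not_le)
    then have bS: "b \<in> ?S" using strict_tableau_outside[OF T, of b] by auto
    have "x (T b) = 0" "y (T b) = 0" using n b by (metis not_le)+
    moreover have "f_skew a {c \<in> ?S. T c = T b} 0 0 = 0"
    proof (rule f_skew_zero)
      show "finite {c \<in> ?S. T c = T b}" using fin by simp
      show "{c \<in> ?S. T c = T b} \<noteq> {}" using bS by blast
    qed
    ultimately have "f_skew a {c \<in> ?S. T c = T b} (x (T b)) (y (T b)) = 0" by simp
    then have "\<exists>k\<in>T ` ?S. f_skew a {c \<in> ?S. T c = k} (x k) (y k) = 0" using bS by (intro bexI[of _ "T b"]) simp_all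
    then show "?w T = 0" by (rule prod_zero[OF finite_imageI[OF fin]])
  qed
qed

end
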